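(* Let $a_1,b_1,a_2,b_2>0$ be real numbers, and denote $$a_+=\frac{a_1+a_2}{2},\quad a_-=\frac{a_1-a_2}{2},\quad b_+=\frac{b_1+b_2}{2},\quad b_-=\frac{b_1-b_2}{2},\quad c=\frac{a_1b_1-a_2b_2}{2},\quad d=\frac{a_1b_2-a_2b_1}{2}.$$ Let $W=\{W_t,\ t\geqslant 0\}$ be a standard Brownian motion and let $$k(a_1,b_1;a_2,b_2)=\mathbb{P}\big[-a_1t-b_1\leqslant W_t\leqslant a_2t+b_2\ \text{ for all } t\geqslant 0\big].$$ Then $$k(a_1,b_1;a_2,b_2)=\sqrt{\frac{\pi}{2a_+b_+}}\;e^{\frac{d^2}{2a_+b_+}}\sum_{n=1}^{+\infty}\left(e^{-\frac{\pi^2(2n)^2}{8a_+b_+}}\left(\cos\left(\frac{\pi(2n)d}{2a_+b_+}\right)-\cos\left(\frac{\pi(2n)c}{2a_+b_+}\right)\right)+e^{-\frac{\pi^2(2n-1)^2}{8a_+b_+}}\left(\cos\left(\frac{\pi(2n-1)d}{2a_+b_+}\right)+\cos\left(\frac{\pi(2n-1)c}{2a_+b_+}\right)\right)\right).$$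
   Context: A standard Brownian motion $W=\{W_t,\ t\geqslant 0\}$ (started at $W_0=0$, with continuous paths) is defined on a filtered probability space $(\Omega,\mathcal{F},\mathbb{P})$. The quantity $k(a_1,b_1;a_2,b_2)$ is called the wedge probability. *)

theory Defs
  imports "HOL-Probability.Probability"
begin

(* Time is the half-line t \<ge> 0: nothing is assumed about F t and W t for negative t.
   The filtration is arbitrary; a Brownian motion given without a filtration is
   the case where F is its natural filtration. *)

locale filtered_prob_space = prob_space M
  for M :: "'a measure" +
  fixes F :: "real \<Rightarrow> 'a measure"
  assumes subalgebra_F: "0 \<le> t \<Longrightarrow> subalgebra M (F t)"
    and F_mono: "0 \<le> s \<Longrightarrow> s \<le> t \<Longrightarrow> sets (F s) \<subseteq> sets (F t)"

(* The second parameter of normal_density is the standard deviation, so an increment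
   over {s..t} has variance t - s. *)

locale standard_brownian_motion = filtered_prob_space M F
  for M :: "'a measure" and F :: "real \<Rightarrow> 'a measure" +
  fixes W :: "real \<Rightarrow> 'a \<Rightarrow> real"
  assumes adapted: "0 \<le> t \<Longrightarrow> W t \<in> borel_measurable (F t)"
    and start_zero: "\<omega> \<in> space M \<Longrightarrow> W 0 \<omega> = 0"
    and continuous_paths: "\<omega> \<in> space M \<Longrightarrow> continuous_on {0..} (\<lambda>t. W t \<omega>)"
    and indep_increments: "0 \<le> s \<Longrightarrow> s < t \<Longrightarrow>
      indep_set (sets (F s))
        (sets (vimage_algebra (space M) (\<lambda>\<omega>. W t \<omega> - W s \<omega>) borel))"
    and normal_increments: "0 \<le> s \<Longrightarrow> s < t \<Longrightarrow>
      distributed M lborel (\<lambda>\<omega>. W t \<omega> - W s \<omega>) (normal_density 0 (sqrt (t - s)))"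

definition wedge_prob ::
    "'a measure \<Rightarrow> (real \<Rightarrow> 'a \<Rightarrow> real) \<Rightarrow> real \<Rightarrow> real \<Rightarrow> real \<Rightarrow> real \<Rightarrow> real" where
  "wedge_prob M W a1 b1 a2 b2 =
     measure M {\<omega> \<in> space M. \<forall>t\<ge>0. - a1 * t - b1 \<le> W t \<omega> \<and> W t \<omega> \<le> a2 * t + b2}"

definition wedge_term :: "real \<Rightarrow> real \<Rightarrow> real \<Rightarrow> real \<Rightarrow> nat \<Rightarrow> real" where
  "wedge_term ap bp c d n =
     exp (- (pi\<^sup>2 * (2 * real n)\<^sup>2 / (8 * ap * bp))) *
       (cos (pi * (2 * real n) * d / (2 * ap * bp)) - cos (pi * (2 * real n) * c / (2 * ap * bp))) +
     exp (- (pi\<^sup>2 * (2 * real n - 1)\<^sup>2 / (8 * ap * bp))) *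
       (cos (pi * (2 * real n - 1) * d / (2 * ap * bp)) + cos (pi * (2 * real n - 1) * c / (2 * ap * bp)))"

end

(* Each term exp (-2 A) of Doob's series, with the barriers seen from the point (t, x), is a
   constant times exp (l x - l^2 t / 2). Stopped at the exit time from the wedge (before a
   horizon T), the series is therefore a bounded martingale; it vanishes on both lines, where
   its terms cancel in pairs, and is close to 1 at time T on the event of no exit, since
   both lines are far away with high probability. Letting T tend to infinity, its value at
   the starting point is the wedge probability. The optional stopping is done along finite
   grids, using only independence and normality of increments. Completing squares turns the
   series into a difference of two Gaussian sums over the integers, and Poisson summation
   converts these into the stated cosine series. Poisson summation itself holds because the
   two sides have the same Fourier coefficients. *)
theory Submission
  imports Defs "HOL-Real_Asymp.Real_Asymp"
begin

subsection \<open>Poisson summation for Gaussians\<close>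

text \<open>Three obstacles shape the details. First, a path stopped at a grid point may already lie
  far outside the wedge, so the stopped exponentials have no common bound while the grid is refined.
  Their squares are, up to a bounded factor, the exponentials with doubled parameter; the resulting
  uniform second moments carry the expectation to the limit. Second, the sum over n has to be
  exchanged with the expectation although one of the two distances may vanish. Only the sum of the
  distances governs the decay in n, and this sum is the gap between the lines, which is at least
  \<open>b1 + b2\<close> at every time; one summable majorant therefore serves all paths and times.
  Third, the periodized Gaussian around a general centre is not even, so cosine coefficients alone
  do not determine it. With the centre fixed, it is symmetrized in an auxiliary variable, and the
  identity is read off at 0.\<close>

lemma summable_on_exp_linear_minus_square:
  fixes b c :: real
  assumes "c > 0"
  shows "(\<lambda>n::int. exp (b * \<bar>real_of_int n\<bar> - c * (real_of_int n)\<^sup>2)) summable_on UNIV"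
proof -
  \<comment> \<open>\<open>K\<close> is the maximum of \<open>(b + 1) * t - c * t^2\<close> over t,
    so the exponent lies below \<open>K - t\<close> and a geometric series of ratio
    \<open>exp (-1)\<close> dominates.\<close>
  define K where "K = (b + 1)\<^sup>2 / (4 * c)"
  have bound: "b * t - c * t\<^sup>2 \<le> K - t" for t :: real
  proof -
    have "0 \<le> (2 * c * t - (b + 1))\<^sup>2 / (4 * c)" using assms by simp
    also have "\<dots> = K - t - (b * t - c * t\<^sup>2)"
      using assms unfolding K_def by (simp add: field_simps power2_eq_square)
    finally show ?thesis by simp
  qed
  have geom: "(\<lambda>n::nat. exp K * exp (-1) ^ n) summable_on UNIV"
    by (intro summable_on_cmult_right summable_nonneg_imp_summable_on summable_geometric) auto
  have half: "(\<lambda>n::nat. exp (b * real n - c * (real n)\<^sup>2)) summable_on UNIV"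
  proof (rule summable_on_comparison_test[OF geom])
    fix n :: nat
    have "exp (b * real n - c * (real n)\<^sup>2) \<le> exp (K - real n)"
      using bound[of "real n"] by simp
    also have "\<dots> = exp K * exp (-1) ^ n"
      by (simp add: exp_diff exp_minus power_inverse field_simps flip: exp_of_nat_mult)
    finally show "exp (b * real n - c * (real n)\<^sup>2) \<le> exp K * exp (-1) ^ n" .
  qed auto
  let ?f = "\<lambda>n::int. exp (b * \<bar>real_of_int n\<bar> - c * (real_of_int n)\<^sup>2)"
  have "?f summable_on range int"
    by (subst summable_on_reindex) (auto simp: o_def half)
  moreover have "?f summable_on range (\<lambda>n. - int n)"
    by (subst summable_on_reindex) (auto simp: o_def half inj_on_def)
  ultimately have "?f summable_on (range int \<union> range (\<lambda>n. - int n))"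
    by (rule summable_on_union)
  moreover have "range int \<union> range (\<lambda>n. - int n) = UNIV"
    by (auto simp: image_iff) (metis int_cases2)
  ultimately show ?thesis by simp
qed

text \<open>Turns unordered sums over the integers into ordinary limits. The intervals are half-open
  so that the unit intervals starting at their members tile \<open>{- N..N}\<close> exactly.\<close>

lemma filterlim_int_intervals:
  "filterlim (\<lambda>N::nat. {- int N..<int N}) (finite_subsets_at_top UNIV) sequentially"
  unfolding filterlim_finite_subsets_at_top
proof (intro allI impI)
  fix X :: "int set"
  assume X: "finite X \<and> X \<subseteq> UNIV"
  obtain B where B: "\<And>x. x \<in> X \<Longrightarrow> \<bar>x\<bar> \<le> B"
    using X by (metis finite_imageI finite_has_maximal2 Max_ge image_eqI)
  show "\<forall>\<^sub>F N in sequentially. finite {- int N..<int N} \<and> X \<subseteq> {- int N..<int N} \<and> {- int N..<int N} \<subseteq> UNIV"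
    using eventually_gt_at_top[of "nat \<bar>B\<bar>"]
  proof eventually_elim
    case (elim N)
    have "X \<subseteq> {- int N..<int N}"
    proof
      fix x assume "x \<in> X"
      from B[OF this] elim show "x \<in> {- int N..<int N}" by auto
    qed
    then show ?case by auto
  qed
qed

text \<open>The product formula trades one factor \<open>cos (2 * pi * y)\<close> for the
  frequencies \<open>m + 1\<close> and \<open>m - 1\<close>, so the induction on the power has to
  treat all frequencies at once.\<close>

lemma integral_times_cos_power_eq_0:
  fixes D :: "real \<Rightarrow> real"
  assumes cont: "continuous_on {0..1} D"
    and int0: "\<And>m::int. integral {0..1} (\<lambda>y. D y * cos (2 * pi * of_int m * y)) = 0"
  shows "integral {0..1} (\<lambda>y. D y * cos (2 * pi * y) ^ k * cos (2 * pi * of_int m * y)) = 0"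
proof (induction k arbitrary: m)
  case 0
  then show ?case using int0 by simp
next
  case (Suc k)
  have eq: "D y * cos (2 * pi * y) ^ Suc k * cos (2 * pi * of_int m * y) =
     (1 / 2) * (D y * cos (2 * pi * y) ^ k * cos (2 * pi * of_int (m + 1) * y)
       + D y * cos (2 * pi * y) ^ k * cos (2 * pi * of_int (m - 1) * y))" for y
  proof -
    have a: "2 * pi * of_int (m + 1) * y = 2 * pi * of_int m * y + 2 * pi * y"
      "2 * pi * of_int (m - 1) * y = 2 * pi * of_int m * y - 2 * pi * y"
      by (simp_all add: algebra_simps)
    show ?thesis unfolding a by (simp add: cos_add cos_diff algebra_simps)
  qed
  have i: "(\<lambda>y. D y * cos (2 * pi * y) ^ k * cos (2 * pi * of_int j * y)) integrable_on {0..1}" for j :: int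
    by (intro integrable_continuous_interval continuous_intros cont)
  show ?case unfolding eq
    unfolding integral_mult_right integral_add[OF i i]
    using Suc[of "m + 1"] Suc[of "m - 1"] by (simp only:) simp
qed

text \<open>Orthogonality to every cosine passes to polynomials in \<open>cos (2 * pi * y)\<close>,
  then to their uniform limits, hence to \<open>D\<close> itself. So the square of \<open>D\<close>
  has integral 0, and continuity forces \<open>D\<close> to vanish.\<close>

lemma even_periodic_eq_0:
  fixes D :: "real \<Rightarrow> real"
  assumes cont: "continuous_on UNIV D"
    and even: "\<And>y. D (- y) = D y" and periodic: "\<And>y. D (y + 1) = D y"
    and int0: "\<And>m::int. integral {0..1} (\<lambda>y. D y * cos (2 * pi * of_int m * y)) = 0"
  shows "D 0 = 0"
proof -
  have contD: "continuous_on S D" for S using cont continuous_on_subset by blast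
  \<comment> \<open>Evenness and periodicity make \<open>D y\<close> a continuous function of \<open>cos (2 * pi * y)\<close>,
    which polynomials in the cosine approximate uniformly.\<close>
  define u where "u v = arccos v / (2 * pi)" for v
  have contDu: "continuous_on {-1..1} (\<lambda>v. D (u v))"
    unfolding u_def
    by (rule continuous_on_compose2[OF cont]) (auto intro!: continuous_intros)
  \<comment> \<open>\<open>arccos\<close> inverts the cosine only on the first half of the period;
    the second half is reflected by \<open>y\<close> to \<open>1 - y\<close>, which leaves
    \<open>D\<close> unchanged.\<close>
  have u_cos: "D (u (cos (2 * pi * y))) = D y" if "y \<in> {0..1}" for y
  proof (cases "y \<le> 1/2")
    case True
    then have "arccos (cos (2 * pi * y)) = 2 * pi * y"
      using that by (intro arccos_cos) auto
    then show ?thesis by (simp add: u_def)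
  next
    case False
    have "cos (2 * pi * y) = cos (2 * pi * (1 - y))"
      by (simp add: right_diff_distrib cos_diff)
    moreover have "arccos (cos (2 * pi * (1 - y))) = 2 * pi * (1 - y)"
      using that False by (intro arccos_cos) auto
    ultimately have "u (cos (2 * pi * y)) = 1 - y" by (simp add: u_def)
    moreover have "D (1 - y) = D y" using periodic[of "-y"] even[of y] by (simp add: algebra_simps)
    ultimately show ?thesis by (simp only:)
  qed
  define B where "B = integral {0..1} (\<lambda>y. \<bar>D y\<bar>)"
  have B0: "B \<ge> 0" unfolding B_def
    by (intro integral_nonneg integrable_continuous_interval continuous_intros contD) auto
  define J where "J = integral {0..1} (\<lambda>y. D y * D y)"
  \<comment> \<open>\<open>D\<close> is orthogonal to \<open>g\<close> of the cosine, so
    \<open>J\<close> is the integral of \<open>D\<close> times the approximation error, and that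
    error is below \<open>e\<close>.\<close>
  have small: "J \<le> e * B" if e: "e > 0" for e
  proof -
    obtain g where g: "real_polynomial_function g" "\<And>v. v \<in> {-1..1} \<Longrightarrow> \<bar>D (u v) - g v\<bar> < e"
      using Stone_Weierstrass_real_polynomial_function[OF _ contDu e] by auto
    then obtain a n where gs: "g = (\<lambda>v. \<Sum>i\<le>n. a i * v ^ i)"
      unfolding real_polynomial_function_iff_sum by blast
    have contg: "continuous_on {0..1} (\<lambda>y. g (cos (2 * pi * y)))"
      unfolding gs by (intro continuous_intros)
    have c0: "integral {0..1} (\<lambda>y. D y * g (cos (2 * pi * y))) = 0"
    proof -
      have "integral {0..1} (\<lambda>y. D y * g (cos (2 * pi * y))) =
          integral {0..1} (\<lambda>y. \<Sum>i\<le>n. a i * (D y * cos (2 * pi * y) ^ i * cos (2 * pi * of_int 0 * y)))"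
        unfolding gs by (simp add: sum_distrib_left algebra_simps)
      also have "\<dots> = (\<Sum>i\<le>n. integral {0..1} (\<lambda>y. a i * (D y * cos (2 * pi * y) ^ i * cos (2 * pi * of_int 0 * y))))"
        by (intro integral_sum integrable_continuous_interval continuous_intros contD) auto
      also have "\<dots> = 0"
        by (simp only: integral_mult_right integral_times_cos_power_eq_0[OF contD int0]) simp
      finally show ?thesis .
    qed
    have "J = integral {0..1} (\<lambda>y. D y * D y) - integral {0..1} (\<lambda>y. D y * g (cos (2 * pi * y)))"
      by (simp add: c0 J_def)
    also have "\<dots> = integral {0..1} (\<lambda>y. D y * D y - D y * g (cos (2 * pi * y)))"
      by (intro integral_diff[symmetric] integrable_continuous_interval continuous_intros contD contg)
    also have "\<dots> \<le> integral {0..1} (\<lambda>y. e * \<bar>D y\<bar>)"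
    proof (intro integral_le integrable_continuous_interval continuous_intros contD contg)
      fix y :: real assume y: "y \<in> {0..1}"
      have "D y * D y - D y * g (cos (2 * pi * y)) \<le> \<bar>D y\<bar> * \<bar>D y - g (cos (2 * pi * y))\<bar>"
        by (metis abs_ge_self abs_mult right_diff_distrib)
      also have "\<dots> \<le> \<bar>D y\<bar> * e"
        using g(2)[of "cos (2 * pi * y)"] u_cos[OF y] by (intro mult_left_mono) auto
      finally show "D y * D y - D y * g (cos (2 * pi * y)) \<le> e * \<bar>D y\<bar>" by (simp add: mult.commute)
    qed
    also have "\<dots> = e * B" by (simp add: B_def)
    finally show ?thesis .
  qed
  have "J \<le> 0"
  proof (rule field_le_epsilon)
    fix e :: real assume "e > 0"
    then have "J \<le> e / (B + 1) * B" using B0 by (intro small) auto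
    also have "\<dots> \<le> e" using B0 \<open>e > 0\<close> by (simp add: field_simps)
    finally show "J \<le> 0 + e" by simp
  qed
  moreover have "J \<ge> 0" unfolding J_def
    by (intro integral_nonneg integrable_continuous_interval continuous_intros contD) auto
  ultimately have "J = 0" by simp
  moreover have "continuous_on {0..1} (\<lambda>y. D y * D y)"
    by (intro continuous_intros contD)
  ultimately have "\<forall>y\<in>{0..1}. D y * D y = 0"
    using integral_eq_0_iff[of 0 1 "\<lambda>y. D y * D y"] unfolding J_def by simp
  then show ?thesis by (auto dest: bspec[of _ _ 0])
qed

text \<open>This is the characteristic function of the standard normal law after the substitution
  \<open>u = (x + y) / \<sigma>\<close>. Its real part gives the cosine integral and its imaginary
  part kills the sine integral, so the shift by \<open>x\<close> contributes only the factor
  \<open>cos (s * x)\<close>. The choice of \<sigma> turns \<open>u^2 / 2\<close> into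
  \<open>\<alpha> * (x + y)^2\<close>.\<close>

lemma gaussian_cos_integral:
  fixes \<alpha> x s :: real
  assumes "\<alpha> > 0"
  shows "integrable lborel (\<lambda>y. exp (- \<alpha> * (x + y)\<^sup>2) * cos (s * y))" (is ?int)
    and "(\<integral>y. exp (- \<alpha> * (x + y)\<^sup>2) * cos (s * y) \<partial>lborel) =
      sqrt (pi / \<alpha>) * exp (- s\<^sup>2 / (4 * \<alpha>)) * cos (s * x)" (is ?eq)
proof -
  define \<sigma> where "\<sigma> = 1 / sqrt (2 * \<alpha>)"
  have \<sigma>: "\<sigma> > 0" "\<sigma>\<^sup>2 = 1 / (2 * \<alpha>)" using assms by (auto simp: \<sigma>_def power_divide)
  define t where "t = s * \<sigma>"
  interpret N: real_distribution std_normal_distribution by (rule real_dist_normal_dist)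
  have ch: "(LINT u|std_normal_distribution. iexp (t * u)) = complex_of_real (exp (- (t^2) / 2))"
    using char_std_normal_distribution unfolding char_def by (metis)
  have ii: "integrable std_normal_distribution (\<lambda>u. iexp (t * u))"
    by (rule N.integrable_const_bound[where B=1]) auto
  have C: "(LINT u|std_normal_distribution. cos (t * u)) = exp (- (t^2) / 2)"
    using arg_cong[OF ch, of Re] integral_Re[OF ii] by (simp add: Re_exp)
  have S: "(LINT u|std_normal_distribution. sin (t * u)) = 0"
    using arg_cong[OF ch, of Im] integral_Im[OF ii] by (simp add: Im_exp)
  have ic: "integrable std_normal_distribution (\<lambda>u. cos (t * u - s * x))" for x
    by (rule N.integrable_const_bound[where B=1]) auto
  have is': "integrable std_normal_distribution (\<lambda>u. cos (t * u))" "integrable std_normal_distribution (\<lambda>u. sin (t * u))"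
    by (rule N.integrable_const_bound[where B=1]; auto)+
  have CS: "(LINT u|std_normal_distribution. cos (t * u - s * x)) = exp (- (t^2) / 2) * cos (s * x)"
    by (simp add: cos_diff C S is')
  have ic': "integrable lborel (\<lambda>u. std_normal_density u * cos (t * u - s * x))"
    using ic[of x] by (subst (asm) integrable_density) auto
  have CS': "(LINT u|lborel. std_normal_density u * cos (t * u - s * x)) = exp (- (t^2) / 2) * cos (s * x)"
    using CS by (subst (asm) integral_density) auto
  let ?g = "\<lambda>u. std_normal_density u * cos (t * u - s * x)"
  have st: "?g (x / \<sigma> + (1 / \<sigma>) * y) = exp (- \<alpha> * (x + y)\<^sup>2) * cos (s * y) / sqrt (2 * pi)" for y
  proof -
    have "(x / \<sigma> + (1 / \<sigma>) * y)\<^sup>2 / 2 = \<alpha> * (x + y)\<^sup>2"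
      using \<sigma> assms by (simp add: add_divide_distrib[symmetric] power_divide)
    moreover have "t * (x / \<sigma> + (1 / \<sigma>) * y) - s * x = s * y"
      using \<sigma> by (simp add: t_def field_simps)
    ultimately show ?thesis
      by (simp add: std_normal_density_def)
  qed
  have "integrable lborel (\<lambda>y. ?g (x / \<sigma> + (1 / \<sigma>) * y))"
    using lborel_integrable_real_affine[OF ic', of "1 / \<sigma>" "x / \<sigma>"] \<sigma> by simp
  then have "integrable lborel (\<lambda>y. sqrt (2 * pi) * ?g (x / \<sigma> + (1 / \<sigma>) * y))"
    by (rule integrable_mult_right)
  then show ?int unfolding st by simp
  have "exp (- (t^2) / 2) * cos (s * x) = (1 / \<sigma>) * (\<integral>y. ?g (x / \<sigma> + (1 / \<sigma>) * y) \<partial>lborel)"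
    using lborel_integral_real_affine[of "1 / \<sigma>" ?g "x / \<sigma>"] \<sigma> unfolding CS' by simp
  also have "\<dots> = (1 / \<sigma>) * ((\<integral>y. exp (- \<alpha> * (x + y)\<^sup>2) * cos (s * y) \<partial>lborel) / sqrt (2 * pi))"
    unfolding st by simp
  finally have "(\<integral>y. exp (- \<alpha> * (x + y)\<^sup>2) * cos (s * y) \<partial>lborel) =
      \<sigma> * sqrt (2 * pi) * exp (- (t^2) / 2) * cos (s * x)"
    using \<sigma> by (simp add: field_simps)
  moreover have "\<sigma> * sqrt (2 * pi) = sqrt (pi / \<alpha>)"
    using assms by (simp add: \<sigma>_def real_sqrt_mult real_sqrt_divide)
  moreover have "t\<^sup>2 / 2 = s\<^sup>2 / (4 * \<alpha>)"
    using \<sigma> by (simp add: t_def power_mult_distrib)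
  ultimately show ?eq by simp
qed

text \<open>The two indicators come from the frequencies \<open>m - k\<close> and
  \<open>m + k\<close> of the product formula. Both equal 1 when \<open>m = k = 0\<close>, which
  accounts for the value 1 there.\<close>

lemma integral_cos_cos_int:
  fixes m k :: int
  shows "integral {0..1} (\<lambda>y. cos (2 * pi * of_int m * y) * cos (2 * pi * of_int k * y)) =
    (of_bool (m = k) + of_bool (m = - k)) / 2"
proof -
  have cos_int: "integral {0..1} (\<lambda>y. cos (2 * pi * of_int j * y)) = of_bool (j = 0)" for j :: int
  proof (cases "j = 0")
    case False
    have "((\<lambda>y. cos (2 * pi * of_int j * y)) has_integral
        (sin (2 * pi * of_int j * 1) / (2 * pi * of_int j) - sin (2 * pi * of_int j * 0) / (2 * pi * of_int j))) {0..1}"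
      using False
      by (intro fundamental_theorem_of_calculus)
        (auto intro!: derivative_eq_intros simp: has_real_derivative_iff_has_vector_derivative[symmetric])
    moreover have "sin (2 * pi * of_int j) = 0"
      using sin_int_2pin by (simp add: mult.commute mult.left_commute)
    ultimately show ?thesis using False by (simp add: integral_unique)
  qed simp
  have eq: "cos (2 * pi * of_int m * y) * cos (2 * pi * of_int k * y) =
      (1 / 2) * (cos (2 * pi * of_int (m - k) * y) + cos (2 * pi * of_int (m + k) * y))" for y
  proof -
    have a: "2 * pi * of_int (m - k) * y = 2 * pi * of_int m * y - 2 * pi * of_int k * y"
      "2 * pi * of_int (m + k) * y = 2 * pi * of_int m * y + 2 * pi * of_int k * y"
      by (simp_all add: algebra_simps)
    show ?thesis unfolding a by (simp add: cos_add cos_diff)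
  qed
  have i: "(\<lambda>y. cos (2 * pi * of_int j * y)) integrable_on {0..1}" for j :: int
    by (intro integrable_continuous_interval continuous_intros)
  show ?thesis
    unfolding eq integral_mult_right integral_add[OF i i] cos_int by (auto simp: eq_neg_iff_add_eq_0)
qed

text \<open>The cross term is at most \<open>2 * R * |n|\<close> and the square of \<open>x\<close>
  is dropped. The bound is uniform over \<open>|x| <= R\<close>, as the Weierstrass test
  requires.\<close>

lemma gaussian_periodization_bound:
  fixes \<alpha> x R :: real
  assumes "\<alpha> > 0" "\<bar>x\<bar> \<le> R"
  shows "exp (- \<alpha> * (of_int n + x)\<^sup>2) \<le> exp (2 * \<alpha> * R * \<bar>of_int n\<bar> - \<alpha> * (of_int n)\<^sup>2)"
proof -
  have "- 2 * of_int n * x \<le> 2 * R * \<bar>of_int n\<bar>"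
    using mult_right_mono[OF assms(2), of "2 * \<bar>of_int n\<bar>"] abs_ge_minus_self[of "2 * of_int n * x"]
    by (simp add: abs_mult algebra_simps)
  then have "- (of_int n + x)\<^sup>2 \<le> 2 * R * \<bar>of_int n\<bar> - (of_int n)\<^sup>2"
    using zero_le_power2[of x] unfolding power2_sum by linarith
  from mult_left_mono[OF this, of \<alpha>] assms show ?thesis by (simp add: algebra_simps)
qed

text \<open>Unfolding: the cosine has period 1, so the summands are integer translates of the single
  function \<open>h\<close>, and the unit intervals tile the line. The coefficient of the
  periodization is therefore the cosine transform of one Gaussian.\<close>

lemma gaussian_periodization_cos_integral:
  fixes \<alpha> x :: real and m :: int
  assumes "\<alpha> > 0"
  shows "integral {0..1} (\<lambda>y. (\<Sum>\<^sub>\<infinity>n::int. exp (- \<alpha> * (of_int n + (x + y))\<^sup>2)) * cos (2 * pi * of_int m * y)) =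
    sqrt (pi / \<alpha>) * exp (- (pi\<^sup>2 * (of_int m)\<^sup>2 / \<alpha>)) * cos (2 * pi * of_int m * x)"
proof -
  define h where "h y = exp (- \<alpha> * (x + y)\<^sup>2) * cos (2 * pi * of_int m * y)" for y
  define f where "f n y = exp (- \<alpha> * (of_int n + (x + y))\<^sup>2) * cos (2 * pi * of_int m * y)" for n :: int and y
  have f_h: "f n y = h (of_int n + y)" for n y
  proof -
    have "cos (2 * pi * of_int m * (of_int n + y)) = cos (2 * pi * of_int m * y + 2 * pi * of_int (m * n))"
      by (simp add: algebra_simps)
    also have "\<dots> = cos (2 * pi * of_int m * y)"
      by (simp only: cos_add cos_int_2pin sin_int_2pin)
    finally show ?thesis by (simp add: f_def h_def algebra_simps)
  qed
  have conth: "continuous_on S h" for S unfolding h_def by (intro continuous_intros)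
  have le: "norm (f n y) \<le> exp (2 * \<alpha> * (\<bar>x\<bar> + 1) * \<bar>of_int n\<bar> - \<alpha> * (of_int n)\<^sup>2)" if "y \<in> {0..1}" for n y
  proof -
    have "norm (f n y) \<le> exp (- \<alpha> * (of_int n + (x + y))\<^sup>2) * 1"
      unfolding f_def norm_mult by (intro mult_mono) auto
    also have "\<dots> \<le> exp (2 * \<alpha> * (\<bar>x\<bar> + 1) * \<bar>of_int n\<bar> - \<alpha> * (of_int n)\<^sup>2)"
      using gaussian_periodization_bound[OF assms, of "x + y" "\<bar>x\<bar> + 1" n] that by auto
    finally show ?thesis .
  qed
  have u: "uniform_limit {0..1} (\<lambda>X y. \<Sum>n\<in>X. f n y) (\<lambda>y. \<Sum>\<^sub>\<infinity>n. f n y) (finite_subsets_at_top UNIV)"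
    by (rule Weierstrass_m_test_general[OF le summable_on_exp_linear_minus_square[OF assms]])
  obtain I J where IJ: "\<And>X. ((\<lambda>y. \<Sum>n\<in>X. f n y) has_integral I X) {0..1}"
      "((\<lambda>y. \<Sum>\<^sub>\<infinity>n. f n y) has_integral J) {0..1}" "(I \<longlongrightarrow> J) (finite_subsets_at_top UNIV)"
    by (rule uniform_limit_integral[OF u])
      (auto intro!: continuous_intros simp: f_def)
  have shift: "(f n has_integral integral {of_int n..of_int (n + 1)} h) {0..1}" for n
  proof -
    have "(h has_integral integral {of_int n..of_int (n + 1)} h) {of_int n..of_int (n + 1)}"
      by (intro integrable_integral integrable_continuous_interval conth)
    from has_integral_affinity[OF this[folded cbox_interval], of 1 "of_int n"]
    show ?thesis
      unfolding f_h by (simp add: add.commute)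
  qed
  \<comment> \<open>Passing from N to \<open>Suc N\<close> adds one unit interval on each
    side.\<close>
  have int_sum: "(\<Sum>n\<in>{- int N..<int N}. integral {of_int n..of_int (n + 1)} h) = integral {- real N..real N} h" for N
  proof (induction N)
    case (Suc N)
    have ends: "{- real N - 1..real N + 1} = {- real (Suc N)..real (Suc N)}" by auto
    have set_eq: "{- int (Suc N)..<int (Suc N)} = insert (- int N - 1) (insert (int N) {- int N..<int N})" by auto
    have "(\<Sum>n\<in>{- int (Suc N)..<int (Suc N)}. integral {of_int n..of_int (n + 1)} h) =
        integral {- real N - 1..- real N} h + integral {real N..real N + 1} h + integral {- real N..real N} h"
      unfolding set_eq Suc[symmetric] by simp
    also have "\<dots> = integral {- real N - 1..real N + 1} h"
      using Henstock_Kurzweil_Integration.integral_combine[of "- real N - 1" "- real N" "real N" h]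
        Henstock_Kurzweil_Integration.integral_combine[of "- real N - 1" "real N" "real N + 1" h]
      by (simp add: integrable_continuous_interval conth)
    finally show ?case unfolding ends .
  qed simp
  have I: "I X = (\<Sum>n\<in>X. integral {of_int n..of_int (n + 1)} h)" if "finite X" for X
    by (rule has_integral_unique[OF IJ(1) has_integral_sum[OF that shift]])
  have inth: "integrable lborel h" unfolding h_def by (rule gaussian_cos_integral(1)[OF assms])
  have "(\<lambda>N. I {- int N..<int N}) \<longlonglongrightarrow> J"
    by (rule filterlim_compose[OF IJ(3) filterlim_int_intervals])
  then have lim1: "(\<lambda>N. integral {- real N..real N} h) \<longlonglongrightarrow> J"
    unfolding I[OF finite_atLeastLessThan_int] int_sum .
  have "(\<lambda>N. \<integral>y. indicator {- real N..real N} y *\<^sub>R h y \<partial>lborel) \<longlonglongrightarrow> (\<integral>y. h y \<partial>lborel)"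
  proof (rule integral_dominated_convergence[where w="\<lambda>y. norm (h y)"])
    show "AE y in lborel. (\<lambda>N. indicator {- real N..real N} y *\<^sub>R h y) \<longlonglongrightarrow> h y"
    proof (rule AE_I2, rule tendsto_eventually)
      fix y
      obtain N0 :: nat where "\<bar>y\<bar> \<le> real N0" using real_arch_simple by blast
      then show "\<forall>\<^sub>F N in sequentially. indicator {- real N..real N} y *\<^sub>R h y = h y"
        by (intro eventually_sequentiallyI[of N0]) (auto simp: indicator_def)
    qed
  qed (use inth in \<open>auto simp: indicator_def\<close>)
  also have "(\<lambda>N. \<integral>y. indicator {- real N..real N} y *\<^sub>R h y \<partial>lborel) = (\<lambda>N. integral {- real N..real N} h)"
  proof
    fix N
    have "set_integrable lborel {- real N..real N} h"
      using inth unfolding set_integrable_def by (intro integrable_mult_indicator) auto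
    from set_borel_integral_eq_integral(2)[OF this]
    show "(\<integral>y. indicator {- real N..real N} y *\<^sub>R h y \<partial>lborel) = integral {- real N..real N} h"
      unfolding set_lebesgue_integral_def .
  qed
  finally have "J = (\<integral>y. h y \<partial>lborel)" using lim1 LIMSEQ_unique by blast
  also have "\<dots> = sqrt (pi / \<alpha>) * exp (- (pi\<^sup>2 * (of_int m)\<^sup>2 / \<alpha>)) * cos (2 * pi * of_int m * x)"
    unfolding h_def gaussian_cos_integral(2)[OF assms] by (simp add: power_mult_distrib)
  moreover have "integral {0..1} (\<lambda>y. \<Sum>\<^sub>\<infinity>n. f n y) = J" by (rule integral_unique[OF IJ(2)])
  moreover have "(\<Sum>\<^sub>\<infinity>n. f n y) = (\<Sum>\<^sub>\<infinity>n::int. exp (- \<alpha> * (of_int n + (x + y))\<^sup>2)) * cos (2 * pi * of_int m * y)" for y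
    unfolding f_def by (rule infsum_cmult_left')
  ultimately show ?thesis by simp
qed

lemma continuous_on_infsum:
  fixes f :: "'i \<Rightarrow> 'b::topological_space \<Rightarrow> real"
  assumes "\<And>n y. y \<in> S \<Longrightarrow> \<bar>f n y\<bar> \<le> M n" and "M summable_on UNIV"
    and "\<And>n. continuous_on S (f n)"
  shows "continuous_on S (\<lambda>y. \<Sum>\<^sub>\<infinity>n. f n y)"
proof (rule uniform_limit_theorem)
  show "uniform_limit S (\<lambda>X y. \<Sum>n\<in>X. f n y) (\<lambda>y. \<Sum>\<^sub>\<infinity>n. f n y) (finite_subsets_at_top UNIV)"
    using assms by (intro Weierstrass_m_test_general[where M=M]) auto
qed (auto intro!: always_eventually continuous_intros assms)

text \<open>Here \<open>x\<close> is fixed and \<open>y\<close> is the Fourier variable. Averaging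
  \<open>G (x + y)\<close> and \<open>G (x - y)\<close> turns the frequency \<open>m\<close> into
  the product of the cosines at \<open>x\<close> and at \<open>y\<close>, which is what \<Theta>
  collects. At \<open>y = 0\<close> the difference \<open>D\<close> is twice the difference of the
  two sides.\<close>

lemma gaussian_poisson_summation:
  fixes \<alpha> x :: real
  assumes "\<alpha> > 0"
  shows "(\<Sum>\<^sub>\<infinity>n::int. exp (- \<alpha> * (of_int n + x)\<^sup>2)) =
    sqrt (pi / \<alpha>) * (\<Sum>\<^sub>\<infinity>m::int. exp (- (pi\<^sup>2 * (of_int m)\<^sup>2 / \<alpha>)) * cos (2 * pi * of_int m * x))"
proof -
  define G where "G x = (\<Sum>\<^sub>\<infinity>n::int. exp (- \<alpha> * (of_int n + x)\<^sup>2))" for x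
  define w where "w m = exp (- (pi\<^sup>2 * (of_int m)\<^sup>2 / \<alpha>)) * cos (2 * pi * of_int m * x)" for m :: int
  define \<Theta> where "\<Theta> y = (\<Sum>\<^sub>\<infinity>m::int. w m * cos (2 * pi * of_int m * y))" for y
  define K where "K = sqrt (pi / \<alpha>)"
  define D where "D y = G (x + y) + G (x - y) - 2 * K * \<Theta> y" for y
  have G_even: "G (- z) = G z" for z
    unfolding G_def
    by (rule infsum_reindex_bij_witness[of _ uminus uminus]) (auto simp: power2_eq_square algebra_simps)
  have G_per: "G (z + 1) = G z" for z
    unfolding G_def
    by (rule infsum_reindex_bij_witness[of _ "\<lambda>n. n - 1" "\<lambda>n. n + 1"]) (auto simp: add_ac)
  have contG': "continuous_on {-R..R} G" for R
    unfolding G_def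
  proof (rule continuous_on_infsum)
    fix n :: int and y assume "y \<in> {-R..R}"
    then show "\<bar>exp (- \<alpha> * (of_int n + y)\<^sup>2)\<bar> \<le> exp (2 * \<alpha> * R * \<bar>of_int n\<bar> - \<alpha> * (of_int n)\<^sup>2)"
      using gaussian_periodization_bound[OF assms, of y R n] by auto
  qed (auto intro!: continuous_intros summable_on_exp_linear_minus_square assms)
  have contG: "continuous_on UNIV G"
  proof (rule continuous_at_imp_continuous_on, rule ballI)
    fix z :: real
    have "z \<in> interior {-(\<bar>z\<bar>+1)..\<bar>z\<bar>+1}" by (auto simp: abs_if)
    then show "isCont G z" using contG'[of "\<bar>z\<bar>+1"] continuous_on_interior by blast
  qed
  \<comment> \<open>The factor 0 puts the majorant in the form of
    \<open>summable_on_exp_linear_minus_square\<close> with no linear term.\<close>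
  define M where "M m = exp (0 * \<bar>of_int m\<bar> - (pi\<^sup>2 / \<alpha>) * (of_int m)\<^sup>2)" for m :: int
  have M_summable: "M summable_on UNIV"
    unfolding M_def using assms by (intro summable_on_exp_linear_minus_square) simp
  have w_le: "\<bar>w m\<bar> \<le> M m" for m
    by (simp add: w_def M_def abs_mult mult_left_le)
  have wcos_le: "\<bar>w m * cos z\<bar> \<le> M m" for m z
    using mult_mono[OF w_le[of m] abs_cos_le_one[of z]] by (simp add: abs_mult M_def)
  have contT: "continuous_on S \<Theta>" for S
    unfolding \<Theta>_def by (rule continuous_on_infsum[OF wcos_le M_summable]) (intro continuous_intros)
  have T_int: "integral {0..1} (\<lambda>y. \<Theta> y * cos (2 * pi * of_int k * y)) = w k" for k
  proof -
    define f where "f m y = w m * cos (2 * pi * of_int m * y) * cos (2 * pi * of_int k * y)" for m y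
    have le: "norm (f m y) \<le> M m" for m y
      using mult_mono[OF wcos_le[of m "2 * pi * of_int m * y"] abs_cos_le_one[of "2 * pi * of_int k * y"]]
      by (simp add: abs_mult f_def M_def)
    have u: "uniform_limit {0..1} (\<lambda>X y. \<Sum>n\<in>X. f n y) (\<lambda>y. \<Sum>\<^sub>\<infinity>n. f n y) (finite_subsets_at_top UNIV)"
      by (rule Weierstrass_m_test_general[OF le M_summable])
    obtain I J where IJ: "\<And>X. ((\<lambda>y. \<Sum>n\<in>X. f n y) has_integral I X) {0..1}"
        "((\<lambda>y. \<Sum>\<^sub>\<infinity>n. f n y) has_integral J) {0..1}" "(I \<longlongrightarrow> J) (finite_subsets_at_top UNIV)"
      by (rule uniform_limit_integral[OF u]) (auto intro!: continuous_intros simp: f_def)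
    have fi: "(f m has_integral (w m * ((of_bool (m = k) + of_bool (m = - k)) / 2))) {0..1}" for m
      unfolding f_def mult.assoc integral_cos_cos_int[symmetric, unfolded mult.assoc]
      by (intro has_integral_mult_right integrable_integral integrable_continuous_interval continuous_intros)
    \<comment> \<open>Each of the indices \<open>k\<close> and \<open>- k\<close> contributes half
      of \<open>w k\<close>; for \<open>k = 0\<close> both halves come from the same index. Hence
      \<open>I\<close> is constant on all finite sets containing both.\<close>
    have I: "I X = w k" if "finite X" "{k, - k} \<subseteq> X" for X
    proof -
      have "I X = (\<Sum>m\<in>X. w m * ((of_bool (m = k) + of_bool (m = - k)) / 2))"
        by (rule has_integral_unique[OF IJ(1) has_integral_sum[OF that(1) fi]])
      also have "\<dots> = (\<Sum>m\<in>X. if m = k then w m / 2 else 0) + (\<Sum>m\<in>X. if m = - k then w m / 2 else 0)"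
        unfolding sum.distrib[symmetric] by (intro sum.cong) auto
      also have "\<dots> = w k / 2 + w (- k) / 2"
        using that by simp
      also have "w (- k) = w k" by (simp add: w_def)
      finally show ?thesis by simp
    qed
    have "(I \<longlongrightarrow> w k) (finite_subsets_at_top UNIV)"
      unfolding tendsto_def eventually_finite_subsets_at_top
      by (intro allI impI exI[of _ "{k, - k}"]) (auto simp: I)
    then have "J = w k" by (rule tendsto_unique[OF finite_subsets_at_top_neq_bot IJ(3)])
    moreover have "(\<Sum>\<^sub>\<infinity>n. f n y) = \<Theta> y * cos (2 * pi * of_int k * y)" for y
      unfolding f_def \<Theta>_def by (rule infsum_cmult_left')
    ultimately show ?thesis using integral_unique[OF IJ(2)] by simp
  qed
  have G_int: "integral {0..1} (\<lambda>y. G (z + y) * cos (2 * pi * of_int m * y)) =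
      K * exp (- (pi\<^sup>2 * (of_int m)\<^sup>2 / \<alpha>)) * cos (2 * pi * of_int m * z)" for z and m :: int
    unfolding G_def K_def by (rule gaussian_periodization_cos_integral[OF assms])
  have "D 0 = 0"
  proof (rule even_periodic_eq_0)
    show "continuous_on UNIV D"
      unfolding D_def by (intro continuous_intros continuous_on_compose2[OF contG] contT) auto
    show "D (- y) = D y" for y by (simp add: D_def \<Theta>_def)
    show "D (y + 1) = D y" for y
    proof -
      have "\<Theta> (y + 1) = \<Theta> y"
        unfolding \<Theta>_def
      proof (rule infsum_cong)
        fix m :: int
        have "2 * pi * of_int m * (y + 1) = 2 * pi * of_int m * y + 2 * pi * of_int m" by (simp add: algebra_simps)
        then show "w m * cos (2 * pi * of_int m * (y + 1)) = w m * cos (2 * pi * of_int m * y)"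
          by (simp only: cos_add cos_int_2pin sin_int_2pin) simp
      qed
      moreover have "G (x + (y + 1)) = G (x + y)" using G_per[of "x + y"] by (simp add: add_ac)
      moreover have "G (x - (y + 1)) = G (x - y)" using G_per[of "x - (y + 1)"] by simp
      ultimately show ?thesis by (simp add: D_def)
    qed
    fix m :: int
    have eq: "D y * cos (2 * pi * of_int m * y) = G (x + y) * cos (2 * pi * of_int m * y)
       + G (- x + y) * cos (2 * pi * of_int m * y) - (2 * K) * (\<Theta> y * cos (2 * pi * of_int m * y))" for y
      using G_even[of "x - y"] by (simp add: D_def algebra_simps)
    have i1: "(\<lambda>y. G (z + y) * cos (2 * pi * of_int m * y)) integrable_on {0..1}" for z
      by (intro integrable_continuous_interval continuous_intros continuous_on_compose2[OF contG]) auto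
    have i2: "(\<lambda>y. \<Theta> y * cos (2 * pi * of_int m * y)) integrable_on {0..1}"
      by (intro integrable_continuous_interval continuous_intros contT)
    show "integral {0..1} (\<lambda>y. D y * cos (2 * pi * of_int m * y)) = 0"
      unfolding eq
      by (subst integral_diff[OF integrable_add[OF i1 i1] integrable_on_mult_right[OF i2]],
          subst integral_add[OF i1 i1], subst integral_mult_right, unfold T_int G_int)
        (simp add: w_def)
  qed
  then show ?thesis
    unfolding D_def by (simp add: G_def K_def \<Theta>_def w_def)
qed

subsection \<open>Stopping on a grid\<close>

text \<open>The step from \<open>t j\<close> to \<open>t (Suc j)\<close> is taken only if
  \<open>P\<close> held at all grid times up to \<open>t j\<close>. The decision to continue is thus
  known before the next increment, as in a discrete stopping time.\<close>

primrec grid_stop :: "(real \<Rightarrow> bool) \<Rightarrow> (nat \<Rightarrow> real) \<Rightarrow> nat \<Rightarrow> real" where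
  "grid_stop P t 0 = t 0"
| "grid_stop P t (Suc j) = (if \<forall>i\<le>j. P (t i) then t (Suc j) else grid_stop P t j)"

lemma grid_stop_eq_last: "(\<And>i. i < n \<Longrightarrow> P (t i)) \<Longrightarrow> grid_stop P t n = t n"
  by (cases n) auto

lemma grid_stop_eq_first:
  assumes "j \<le> n" "\<not> P (t j)" "\<And>i. i < j \<Longrightarrow> P (t i)"
  shows "grid_stop P t n = t j"
  using assms(1)
proof (induction n)
  case (Suc n)
  show ?case
  proof (cases "j \<le> n")
    case True
    then show ?thesis using Suc.IH assms(2) by auto
  next
    case False
    then have "j = Suc n" using Suc.prems by simp
    then show ?thesis using assms(3) by auto
  qed
qed simp

lemma grid_stop_cases:
  obtains (last) "\<And>i. i < n \<Longrightarrow> P (t i)" "grid_stop P t n = t n"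
  | (first) j where "j < n" "\<not> P (t j)" "\<And>i. i < j \<Longrightarrow> P (t i)" "grid_stop P t n = t j"
proof (cases "\<forall>i<n. P (t i)")
  case True
  then show ?thesis using grid_stop_eq_last[of n P t] by (intro that(1)) auto
next
  case False
  define j where "j = (LEAST l. \<not> P (t l))"
  obtain l where l: "l < n" "\<not> P (t l)" using False by blast
  have j: "\<not> P (t j)" "j \<le> l" "\<And>i. i < j \<Longrightarrow> P (t i)"
    unfolding j_def using l(2) LeastI[of "\<lambda>l. \<not> P (t l)" l]
    by (auto intro: Least_le dest: not_less_Least)
  show ?thesis
    using j l grid_stop_eq_first[of j n P t] by (intro that(2)[of j]) auto
qed

text \<open>A grid stop never precedes the true exit time, and continuity keeps \<open>v\<close>
  negative near points just after that time, where a fine enough grid must have a point.\<close>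

lemma grid_stop_converges:
  fixes v :: "real \<Rightarrow> real" and T :: real
  assumes cont: "continuous_on {0..} v" and v0: "v 0 > 0" and T: "T > 0"
  defines "stop \<equiv> \<lambda>m. grid_stop (\<lambda>s. 0 \<le> v s) (\<lambda>j. T * real j / real (Suc m)) (Suc m)"
  obtains \<tau> where "\<tau> \<in> {0..T}" "stop \<longlonglongrightarrow> \<tau>" "\<And>s. s \<in> {0..\<tau>} \<Longrightarrow> 0 \<le> v s"
    "(\<forall>s\<in>{0..T}. 0 \<le> v s) \<and> \<tau> = T \<or> \<not> (\<forall>s\<in>{0..T}. 0 \<le> v s) \<and> \<tau> < T \<and> v \<tau> = 0"
proof (cases "\<forall>s\<in>{0..T}. 0 \<le> v s")
  case True
  have "stop m = T" for m
  proof -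
    have "stop m = T * real (Suc m) / real (Suc m)" unfolding stop_def
    proof (rule grid_stop_eq_last)
      fix i assume "i < Suc m"
      then have "T * real i / real (Suc m) \<in> {0..T}"
        using T mult_left_mono[of "real i" "real (Suc m)" T] by (auto simp: field_simps)
      then show "0 \<le> v (T * real i / real (Suc m))" using True by blast
    qed
    then show ?thesis by simp
  qed
  then have "stop = (\<lambda>_. T)" by auto
  then show ?thesis using that[of T] True T by auto
next
  case False
  \<comment> \<open>Only strictly negative values count as an exit, so touching 0 does not. The
    infimum of \<open>S\<close> turns out to be a zero of \<open>v\<close> and hence not a member of
    \<open>S\<close>.\<close>
  define S where "S = {s \<in> {0..T}. v s < 0}"
  define \<tau> where "\<tau> = Inf S"
  have S: "S \<noteq> {}" "bdd_below S" using False by (auto simp: S_def)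
  have \<tau>_le: "\<tau> \<le> s" if "s \<in> S" for s unfolding \<tau>_def using that S by (intro cInf_lower)
  have \<tau>0: "0 \<le> \<tau>" unfolding \<tau>_def using S by (intro cInf_greatest) (auto simp: S_def)
  obtain s0 where "s0 \<in> S" using S by blast
  then have \<tau>T: "\<tau> \<le> T" using \<tau>_le[of s0] by (auto simp: S_def)
  have before: "0 \<le> v s" if "0 \<le> s" "s < \<tau>" for s
    using \<tau>_le[of s] that \<tau>T by (force simp: S_def)
  have nbhd: "\<exists>d>0. \<forall>s\<ge>0. \<bar>s - u\<bar> < d \<longrightarrow> \<bar>v s - v u\<bar> < e" if "0 \<le> u" "e > 0" for u e
    using cont[unfolded continuous_on_iff dist_real_def, rule_format, of u e] that by auto
  have v\<tau>: "v \<tau> = 0"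
  proof (rule ccontr)
    assume "v \<tau> \<noteq> 0"
    then obtain d where d: "d > 0" "\<And>s. s \<ge> 0 \<Longrightarrow> \<bar>s - \<tau>\<bar> < d \<Longrightarrow> \<bar>v s - v \<tau>\<bar> < \<bar>v \<tau>\<bar>"
      using nbhd[OF \<tau>0, of "\<bar>v \<tau>\<bar>"] by auto
    show False
    proof (cases "v \<tau> > 0")
      case True
      obtain s where s: "s \<in> S" "s < \<tau> + d"
        using cInf_lessD[OF S(1), of "\<tau> + d"] d(1) unfolding \<tau>_def by auto
      have "\<bar>v s - v \<tau>\<bar> < \<bar>v \<tau>\<bar>" using s \<tau>_le[OF s(1)] by (intro d) (auto simp: S_def)
      then show False using s(1) True by (auto simp: S_def)
    next
      case neg: False
      then have "\<tau> \<noteq> 0" using v0 by auto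
      define s where "s = max 0 (\<tau> - d / 2)"
      have s: "0 \<le> s" "s < \<tau>" "\<bar>s - \<tau>\<bar> < d" using \<open>\<tau> \<noteq> 0\<close> \<tau>0 d(1) by (auto simp: s_def)
      then show False using before[OF s(1,2)] d(2)[OF s(1,3)] neg by auto
    qed
  qed
  have \<tau>_less: "\<tau> < T"
    using \<tau>_le[OF \<open>s0 \<in> S\<close>] \<open>s0 \<in> S\<close> v\<tau> by (cases "\<tau> = s0") (auto simp: S_def)
  have upto: "0 \<le> v s" if "s \<in> {0..\<tau>}" for s
    using before[of s] v\<tau> that by (cases "s = \<tau>") auto
  have stop_ge: "\<tau> \<le> stop m" for m
  proof (cases rule: grid_stop_cases[where n="Suc m" and P="\<lambda>s. 0 \<le> v s" and t="\<lambda>j. T * real j / real (Suc m)"])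
    case last
    then show ?thesis using \<tau>T by (simp add: stop_def)
  next
    case (first j)
    have "T * real j / real (Suc m) \<in> S"
      using first(1,2) T mult_left_mono[of "real j" "real (Suc m)" T] by (auto simp: S_def field_simps)
    then show ?thesis using first(4) \<tau>_le by (simp add: stop_def)
  qed
  have "stop \<longlonglongrightarrow> \<tau>"
  proof (rule LIMSEQ_I)
    fix e :: real assume "e > 0"
    \<comment> \<open>\<open>v\<close> is negative at \<open>u\<close>, shortly after \<tau>, and
      stays negative within \<open>d\<close> of it. Once the mesh is below \<open>d\<close>, the
      last grid point \<open>j\<close> not beyond \<open>u\<close> is such a negative point, so the
      stop is at most \<open>u\<close>.\<close>
    obtain u where u: "u \<in> S" "u < \<tau> + e"
      using cInf_lessD[OF S(1), of "\<tau> + e"] \<open>e > 0\<close> unfolding \<tau>_def by auto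
    obtain d where d: "d > 0" "\<And>s. s \<ge> 0 \<Longrightarrow> \<bar>s - u\<bar> < d \<Longrightarrow> \<bar>v s - v u\<bar> < - v u"
      using nbhd[of u "- v u"] u(1) by (auto simp: S_def)
    obtain N :: nat where N: "T / d < real N" using reals_Archimedean2 by blast
    have "norm (stop m - \<tau>) < e" if "m \<ge> N" for m
    proof -
      define j where "j = nat \<lfloor>u * real (Suc m) / T\<rfloor>"
      have u0: "0 \<le> u" "u \<le> T" using u(1) by (auto simp: S_def)
      have "0 \<le> u * real (Suc m) / T" using u0 T by simp
      then have j: "real j \<le> u * real (Suc m) / T" "u * real (Suc m) / T < real j + 1"
        unfolding j_def by linarith+
      have "T * real j / real (Suc m) \<le> u" using j(1) T by (simp add: field_simps)
      moreover have "u < T * real j / real (Suc m) + T / real (Suc m)"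
      proof -
        have "u < T * (real j + 1) / real (Suc m)" using j(2) T by (simp add: field_simps)
        then show ?thesis by (simp only: distrib_left add_divide_distrib mult_1_right)
      qed
      moreover have "T / real (Suc m) < d"
      proof -
        have "T / d < real (Suc m)" using N that by linarith
        then show ?thesis using d(1) by (simp add: field_simps)
      qed
      ultimately have t: "T * real j / real (Suc m) \<le> u" "\<bar>T * real j / real (Suc m) - u\<bar> < d" by linarith+
      have bad: "v (T * real j / real (Suc m)) < 0"
        using d(2)[OF _ t(2)] T u(1) by (auto simp: S_def)
      have "stop m \<le> u"
      proof (cases rule: grid_stop_cases[where n="Suc m" and P="\<lambda>s. 0 \<le> v s" and t="\<lambda>j. T * real j / real (Suc m)"])
        case last
        have "j \<ge> Suc m" using last(1)[of j] bad by force
        then have "T \<le> T * real j / real (Suc m)"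
          using T mult_left_mono[of "real (Suc m)" "real j" T] by (simp add: field_simps)
        then show ?thesis using t(1) last(2) by (simp add: stop_def)
      next
        case (first i)
        have "i \<le> j" using first(3)[of j] bad by force
        then have "T * real i / real (Suc m) \<le> T * real j / real (Suc m)"
          using T by (intro divide_right_mono mult_left_mono) auto
        then show ?thesis using t(1) first(4) by (simp add: stop_def)
      qed
      then show ?thesis using stop_ge[of m] u(2) by auto
    qed
    then show "\<exists>N. \<forall>m\<ge>N. norm (stop m - \<tau>) < e" by blast
  qed
  then show ?thesis using that[of \<tau>] \<tau>0 \<tau>_less upto v\<tau> False by auto
qed

section \<open>Exponential martingales stopped on a grid\<close>

text \<open>Completing the square: the exponential weight only moves the mean of the normal law to
  \<open>\<theta> * \<sigma>^2\<close>. The weighted density is again a probability density, which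
  is why the exponential of an increment has expectation 1.\<close>

lemma normal_density_exp_tilt:
  fixes \<theta> \<sigma> x :: real
  assumes "\<sigma> > 0"
  shows "normal_density 0 \<sigma> x * exp (\<theta> * x - \<theta>\<^sup>2 * \<sigma>\<^sup>2 / 2) = normal_density (\<theta> * \<sigma>\<^sup>2) \<sigma> x"
proof -
  have "- (x - 0)\<^sup>2 / (2 * \<sigma>\<^sup>2) + (\<theta> * x - \<theta>\<^sup>2 * \<sigma>\<^sup>2 / 2) = - (x - \<theta> * \<sigma>\<^sup>2)\<^sup>2 / (2 * \<sigma>\<^sup>2)"
    using assms by (simp add: field_simps power2_eq_square)
  then show ?thesis by (simp add: normal_density_def flip: exp_add)
qed

lemma (in prob_space) indep_set_mono:
  assumes "indep_set A B" "A' \<subseteq> A" "B' \<subseteq> B"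
  shows "indep_set A' B'"
  using assms(1) unfolding indep_set_def
  by (rule indep_sets_mono_sets) (use assms(2,3) in \<open>auto split: bool.splits\<close>)

lemma (in prob_space) indep_var_of_indep_set:
  assumes "indep_set A B" "X \<in> borel_measurable M" "Y \<in> borel_measurable M"
    and "\<And>S. S \<in> sets borel \<Longrightarrow> X -` S \<inter> space M \<in> A"
    and "\<And>S. S \<in> sets borel \<Longrightarrow> Y -` S \<inter> space M \<in> B"
    and "sigma_algebra (space M) A" "sigma_algebra (space M) B"
  shows "indep_var borel X borel Y"
  unfolding indep_var_eq
proof (intro conjI indep_set_mono[OF assms(1)])
  show "sigma_sets (space M) {X -` S \<inter> space M | S. S \<in> sets borel} \<subseteq> A"
    using assms(4) by (intro sigma_algebra.sigma_sets_subset[OF assms(6)]) auto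
  show "sigma_sets (space M) {Y -` S \<inter> space M | S. S \<in> sets borel} \<subseteq> B"
    using assms(5) by (intro sigma_algebra.sigma_sets_subset[OF assms(7)]) auto
qed (use assms(2,3) in auto)

text \<open>Bounded second moments make the \<open>Z m\<close> uniformly integrable, which pointwise
  convergence alone would not give. A bound is asked of the limit \<open>Y\<close> only, so that it
  is unaffected by truncation at large levels.\<close>

lemma (in prob_space) expectation_limit_square_bounded:
  fixes Z :: "nat \<Rightarrow> 'a \<Rightarrow> real"
  assumes "\<And>m. integrable M (Z m)" "\<And>m. integrable M (\<lambda>\<omega>. (Z m \<omega>)\<^sup>2)"
    and "\<And>m. expectation (Z m) = e" and "\<And>m. expectation (\<lambda>\<omega>. (Z m \<omega>)\<^sup>2) \<le> C"
    and "\<And>m \<omega>. \<omega> \<in> space M \<Longrightarrow> 0 \<le> Z m \<omega>"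
    and "\<And>\<omega>. \<omega> \<in> space M \<Longrightarrow> (\<lambda>m. Z m \<omega>) \<longlonglongrightarrow> Y \<omega>"
    and "\<And>\<omega>. \<omega> \<in> space M \<Longrightarrow> Y \<omega> \<le> B"
  shows "expectation Y = e"
proof -
  have [measurable]: "Z m \<in> borel_measurable M" for m using assms(1) by auto
  have Y_meas[measurable]: "Y \<in> borel_measurable M"
    by (rule borel_measurable_LIMSEQ_real[OF assms(6)]) auto
  have Y0: "0 \<le> Y \<omega>" if "\<omega> \<in> space M" for \<omega>
    using assms(5,6) that by (meson LIMSEQ_le_const)
  have C0: "0 \<le> C" using order_trans[OF integral_nonneg_AE assms(4)] by auto
  \<comment> \<open>Truncating at level \<open>K\<close> costs at most \<open>C / K\<close> in expectation.\<close>
  have bounds: "e - C / K \<le> expectation Y \<and> expectation Y \<le> e" if K: "K \<ge> B" "K > 0" for K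
  proof -
    have int: "integrable M (\<lambda>\<omega>. min (Z m \<omega>) K)" for m
      by (rule integrable_const_bound[where B=K]) (use assms(5) K in auto)
    have "(\<lambda>m. expectation (\<lambda>\<omega>. min (Z m \<omega>) K)) \<longlonglongrightarrow> expectation (\<lambda>\<omega>. min (Y \<omega>) K)"
    proof (rule integral_dominated_convergence[where w="\<lambda>_. K"])
      show "AE \<omega> in M. (\<lambda>m. min (Z m \<omega>) K) \<longlonglongrightarrow> min (Y \<omega>) K"
        by (intro AE_I2 tendsto_min tendsto_const assms(6))
    qed (use assms(5) K in \<open>auto\<close>)
    also have "expectation (\<lambda>\<omega>. min (Y \<omega>) K) = expectation Y"
      by (rule Bochner_Integration.integral_cong) (use assms(7) K in \<open>force simp: min_def\<close>)+
    finally have lim: "(\<lambda>m. expectation (\<lambda>\<omega>. min (Z m \<omega>) K)) \<longlonglongrightarrow> expectation Y" .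
    have up: "expectation (\<lambda>\<omega>. min (Z m \<omega>) K) \<le> e" for m
      unfolding assms(3)[of m, symmetric] by (intro integral_mono int assms) auto
    have lo: "e - C / K \<le> expectation (\<lambda>\<omega>. min (Z m \<omega>) K)" for m
    proof -
      \<comment> \<open>Above the level \<open>K\<close> the left side is at most 0, because there
        \<open>Z m \<omega>\<close> is below its square divided by \<open>K\<close>.\<close>
      have pt: "Z m \<omega> - (Z m \<omega>)\<^sup>2 / K \<le> min (Z m \<omega>) K" if "\<omega> \<in> space M" for \<omega>
      proof (cases "Z m \<omega> \<le> K")
        case False
        then have "Z m \<omega> \<le> (Z m \<omega>)\<^sup>2 / K" using K by (simp add: field_simps power2_eq_square)
        then show ?thesis using K by (simp add: min_def)
      qed (use K in auto)
      have "e - C / K \<le> expectation (Z m) - expectation (\<lambda>\<omega>. (Z m \<omega>)\<^sup>2) / K"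
        using assms(3,4)[of m] K by (simp add: divide_right_mono)
      also have "\<dots> = expectation (\<lambda>\<omega>. Z m \<omega> - (Z m \<omega>)\<^sup>2 / K)"
        using assms(1,2) by simp
      also have "\<dots> \<le> expectation (\<lambda>\<omega>. min (Z m \<omega>) K)"
        using assms(1,2) by (intro integral_mono int pt) auto
      finally show ?thesis .
    qed
    show ?thesis
      using LIMSEQ_le_const[OF lim] LIMSEQ_le_const2[OF lim] up lo by blast
  qed
  have "e \<le> expectation Y"
  proof (rule field_le_epsilon)
    fix \<epsilon> :: real assume "\<epsilon> > 0"
    define K where "K = max (max 1 B) (C / \<epsilon>)"
    have "C / K \<le> \<epsilon>"
    proof -
      have "C / \<epsilon> \<le> K" "0 < K" by (auto simp: K_def less_max_iff_disj)
      then show ?thesis using \<open>\<epsilon> > 0\<close> by (simp add: field_simps)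
    qed
    moreover have "B \<le> K" "1 \<le> K" by (simp_all add: K_def le_max_iff_disj)
    ultimately show "e \<le> expectation Y + \<epsilon>" using bounds[of K] by auto
  qed
  moreover have "expectation Y \<le> e" using bounds[of "max 1 B"] by auto
  ultimately show ?thesis by simp
qed

context standard_brownian_motion
begin

lemma W_measurable: "0 \<le> t \<Longrightarrow> W t \<in> borel_measurable M"
  using adapted subalgebra_F measurable_from_subalg by blast

lemma W_measurable_later: "0 \<le> s \<Longrightarrow> s \<le> t \<Longrightarrow> W s \<in> borel_measurable (F t)"
  using adapted[of s] F_mono[of s t] subalgebra_F[of s] subalgebra_F[of t]
  unfolding measurable_def subalgebra_def by auto

lemma exp_increment:
  fixes \<theta> :: real
  assumes "0 \<le> s" "s < t"
  defines "E \<equiv> \<lambda>\<omega>. exp (\<theta> * (W t \<omega> - W s \<omega>) - \<theta>\<^sup>2 * (t - s) / 2)"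
  shows "integrable M E" "expectation E = 1"
proof -
  have sq: "(sqrt (t - s))\<^sup>2 = t - s" using assms by simp
  have st: "sqrt (t - s) > 0" using assms by simp
  let ?g = "\<lambda>x. exp (\<theta> * x - \<theta>\<^sup>2 * (t - s) / 2)"
  have g: "normal_density 0 (sqrt (t - s)) x * ?g x = normal_density (\<theta> * (t - s)) (sqrt (t - s)) x" for x
    using normal_density_exp_tilt[OF st, of x \<theta>] unfolding sq .
  note D = normal_increments[OF assms(1,2)]
  show "integrable M E"
    using distributed_integrable[OF D, of ?g] st unfolding g E_def by auto
  show "expectation E = 1"
    using distributed_integral[OF D, of ?g] st unfolding g E_def by auto
qed

lemma expectation_mult_increment:
  assumes st: "0 \<le> s" "s < t" and X: "X \<in> borel_measurable (F s)" "integrable M X"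
    and g: "g \<in> borel_measurable borel" "integrable M (\<lambda>\<omega>. g (W t \<omega> - W s \<omega>))"
  shows "integrable M (\<lambda>\<omega>. X \<omega> * g (W t \<omega> - W s \<omega>))"
    "expectation (\<lambda>\<omega>. X \<omega> * g (W t \<omega> - W s \<omega>)) = expectation X * expectation (\<lambda>\<omega>. g (W t \<omega> - W s \<omega>) :: real)"
proof -
  let ?V = "vimage_algebra (space M) (\<lambda>\<omega>. W t \<omega> - W s \<omega>) borel"
  have sp: "space (F s) = space M" using subalgebra_F[OF st(1)] by (simp add: subalgebra_def)
  have "indep_var borel X borel (\<lambda>\<omega>. g (W t \<omega> - W s \<omega>))"
  proof (rule indep_var_of_indep_set[OF indep_increments[OF st]])
    show "X -` S \<inter> space M \<in> sets (F s)" if "S \<in> sets borel" for S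
      using measurable_sets[OF X(1) that] sp by simp
    show "(\<lambda>\<omega>. g (W t \<omega> - W s \<omega>)) -` S \<inter> space M \<in> sets ?V" if "S \<in> sets borel" for S
    proof -
      have "(\<lambda>\<omega>. g (W t \<omega> - W s \<omega>)) -` S \<inter> space M = (\<lambda>\<omega>. W t \<omega> - W s \<omega>) -` (g -` S) \<inter> space M" by auto
      moreover have "g -` S \<in> sets borel" using measurable_sets[OF g(1) that] by simp
      ultimately show ?thesis by (simp add: in_vimage_algebra)
    qed
    show "sigma_algebra (space M) (sets (F s))" using sets.sigma_algebra_axioms[of "F s"] sp by simp
    show "sigma_algebra (space M) (sets ?V)" using sets.sigma_algebra_axioms[of ?V] by simp
  qed (use X g in auto)
  from indep_var_integrable[OF this X(2) g(2)] indep_var_lebesgue_integral[OF this X(2) g(2)]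
  show "integrable M (\<lambda>\<omega>. X \<omega> * g (W t \<omega> - W s \<omega>))"
    "expectation (\<lambda>\<omega>. X \<omega> * g (W t \<omega> - W s \<omega>)) = expectation X * expectation (\<lambda>\<omega>. g (W t \<omega> - W s \<omega>))"
    by auto
qed

lemma grid_stop_measurable:
  assumes [measurable]: "\<And>i. I i \<in> sets borel" and t: "\<And>i. 0 \<le> t i"
    and P: "\<And>\<omega> i. \<omega> \<in> space M \<Longrightarrow> P \<omega> (t i) \<longleftrightarrow> W (t i) \<omega> \<in> I i"
  shows "(\<lambda>\<omega>. grid_stop (P \<omega>) t n) \<in> borel_measurable M"
    "(\<lambda>\<omega>. W (grid_stop (P \<omega>) t n) \<omega>) \<in> borel_measurable M"
proof -
  have [measurable]: "W (t i) \<in> borel_measurable M" for i using W_measurable t by blast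
  have "Measurable.pred M (\<lambda>\<omega>. \<forall>i\<le>n. P \<omega> (t i))" for n
  proof -
    have "Measurable.pred M (\<lambda>\<omega>. \<forall>i\<le>n. P \<omega> (t i)) \<longleftrightarrow>
        Measurable.pred M (\<lambda>\<omega>. \<forall>i\<le>n. W (t i) \<omega> \<in> I i)"
      by (rule measurable_cong) (simp add: P)
    also have "\<dots>" by measurable
    finally show ?thesis .
  qed
  then have set: "{\<omega> \<in> space M. \<forall>i\<le>n. P \<omega> (t i)} \<in> sets M" for n
    unfolding pred_def .
  show "(\<lambda>\<omega>. grid_stop (P \<omega>) t n) \<in> borel_measurable M"
  proof (induction n)
    case 0
    show ?case unfolding grid_stop.simps by (rule measurable_const) simp
  next
    case (Suc n)
    show ?case unfolding grid_stop.simps by (rule measurable_If[OF measurable_const Suc set]) simp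
  qed
  show "(\<lambda>\<omega>. W (grid_stop (P \<omega>) t n) \<omega>) \<in> borel_measurable M"
  proof (induction n)
    case 0
    show ?case unfolding grid_stop.simps by (rule W_measurable[OF t])
  next
    case (Suc n)
    have "W (grid_stop (P \<omega>) t (Suc n)) \<omega> =
        (if \<forall>i\<le>n. P \<omega> (t i) then W (t (Suc n)) \<omega> else W (grid_stop (P \<omega>) t n) \<omega>)" for \<omega>
      by auto
    then show ?case by (simp only: measurable_If[OF W_measurable[OF t] Suc set])
  qed
qed

text \<open>One step changes \<open>Z\<close> by \<open>X * g\<close>, where \<open>X\<close> is
  known at the earlier grid time and vanishes once the path has been stopped, and \<open>g\<close>
  of the next increment has expectation 0. The bounded sets \<open>I i\<close> make \<open>X\<close>
  bounded, hence integrable, and independence then gives the product expectation 0.\<close>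

lemma grid_stopped_exp:
  fixes \<theta> :: real
  assumes I: "\<And>i. I i \<in> sets borel" "\<And>i x. x \<in> I i \<Longrightarrow> \<bar>x\<bar> \<le> B i"
    and t: "t 0 = 0" "\<And>i. t i < t (Suc i)"
    and P: "\<And>\<omega> i. \<omega> \<in> space M \<Longrightarrow> P \<omega> (t i) \<longleftrightarrow> W (t i) \<omega> \<in> I i"
  defines "Z \<equiv> \<lambda>n \<omega>. exp (\<theta> * W (grid_stop (P \<omega>) t n) \<omega> - \<theta>\<^sup>2 * grid_stop (P \<omega>) t n / 2)"
  shows "integrable M (Z n) \<and> expectation (Z n) = 1"
proof (induction n)
  case 0
  have "expectation (Z 0) = expectation (\<lambda>_. 1)"
    by (rule Bochner_Integration.integral_cong) (auto simp: Z_def t start_zero)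
  moreover have "integrable M (Z 0) \<longleftrightarrow> integrable M (\<lambda>_. 1 :: real)"
    by (rule Bochner_Integration.integrable_cong) (auto simp: Z_def t start_zero)
  ultimately show ?case by (simp add: prob_space)
next
  case (Suc n)
  have mono: "t i \<le> t j" if "i \<le> j" for i j
    using that by (rule lift_Suc_mono_le[of t, rotated]) (simp add: t(2) less_imp_le)
  have t0: "0 \<le> t i" for i using mono[of 0 i] t(1) by simp
  let ?s = "t n" and ?t = "t (Suc n)"
  define X where "X \<omega> = (if \<forall>i\<le>n. W (t i) \<omega> \<in> I i then exp (\<theta> * W ?s \<omega> - \<theta>\<^sup>2 * ?s / 2) else 0)" for \<omega>
  define g where "g x = exp (\<theta> * x - \<theta>\<^sup>2 * (?t - ?s) / 2) - 1" for x
  have Xm: "X \<in> borel_measurable (F ?s)"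
  proof -
    have "{\<omega> \<in> space (F ?s). \<forall>i\<le>n. W (t i) \<omega> \<in> I i} = {\<omega> \<in> space (F ?s). \<forall>i\<in>{..n}. W (t i) \<omega> \<in> I i}" by auto
    also have "\<dots> \<in> sets (F ?s)"
    proof (rule sets.sets_Collect_finite_All')
      fix i assume "i \<in> {..n}"
      then have "(\<lambda>\<omega>. W (t i) \<omega>) \<in> borel_measurable (F ?s)" using W_measurable_later[OF t0 mono] by auto
      from measurable_sets[OF this I(1)[of i]]
      show "{\<omega> \<in> space (F ?s). W (t i) \<omega> \<in> I i} \<in> sets (F ?s)"
        by (simp add: vimage_def Int_def conj_commute)
    qed auto
    finally have set: "{\<omega> \<in> space (F ?s). \<forall>i\<le>n. W (t i) \<omega> \<in> I i} \<in> sets (F ?s)" .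
    have "(\<lambda>\<omega>. exp (\<theta> * W ?s \<omega> - \<theta>\<^sup>2 * ?s / 2)) \<in> borel_measurable (F ?s)"
      using adapted[OF t0] by measurable
    from measurable_If[OF this measurable_const set]
    show ?thesis unfolding X_def by simp
  qed
  have Xi: "integrable M X"
  proof (rule integrable_const_bound[where B="exp (\<bar>\<theta>\<bar> * B n)"])
    have "\<theta> * W ?s \<omega> - \<theta>\<^sup>2 * ?s / 2 \<le> \<bar>\<theta>\<bar> * B n" if "W ?s \<omega> \<in> I n" for \<omega>
    proof -
      have "\<theta> * W ?s \<omega> \<le> \<bar>\<theta>\<bar> * \<bar>W ?s \<omega>\<bar>" by (metis abs_ge_self abs_mult)
      also have "\<dots> \<le> \<bar>\<theta>\<bar> * B n" using I(2)[OF that] by (intro mult_left_mono) auto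
      moreover have "0 \<le> \<theta>\<^sup>2 * ?s / 2" using t0 by simp
      ultimately show ?thesis by linarith
    qed
    then show "AE \<omega> in M. norm (X \<omega>) \<le> exp (\<bar>\<theta>\<bar> * B n)" by (auto simp: X_def)
    show "X \<in> borel_measurable M" using Xm subalgebra_F[OF t0] measurable_from_subalg by blast
  qed
  have gi: "integrable M (\<lambda>\<omega>. g (W ?t \<omega> - W ?s \<omega>))" "expectation (\<lambda>\<omega>. g (W ?t \<omega> - W ?s \<omega>)) = 0"
    using exp_increment[OF t0 t(2), where \<theta>=\<theta>] unfolding g_def by (simp_all add: prob_space)
  have XY: "integrable M (\<lambda>\<omega>. X \<omega> * g (W ?t \<omega> - W ?s \<omega>))"
    "expectation (\<lambda>\<omega>. X \<omega> * g (W ?t \<omega> - W ?s \<omega>)) = 0"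
    using expectation_mult_increment[OF t0 t(2) Xm Xi _ gi(1)] gi(2) by (simp_all add: g_def)
  have step: "Z (Suc n) \<omega> = Z n \<omega> + X \<omega> * g (W ?t \<omega> - W ?s \<omega>)" if \<omega>: "\<omega> \<in> space M" for \<omega>
  proof (cases "\<forall>i\<le>n. P \<omega> (t i)")
    case True
    then have "grid_stop (P \<omega>) t n = t n" by (intro grid_stop_eq_last) auto
    moreover have "X \<omega> = exp (\<theta> * W ?s \<omega> - \<theta>\<^sup>2 * ?s / 2)" using True P[OF \<omega>] by (simp add: X_def)
    ultimately show ?thesis using True
      by (simp add: Z_def g_def algebra_simps diff_divide_distrib flip: exp_add)
  next
    case False
    then have "X \<omega> = 0" using P[OF \<omega>] by (auto simp: X_def)
    then show ?thesis using False by (auto simp: Z_def)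
  qed
  have "integrable M (Z (Suc n)) \<longleftrightarrow> integrable M (\<lambda>\<omega>. Z n \<omega> + X \<omega> * g (W ?t \<omega> - W ?s \<omega>))"
    by (rule Bochner_Integration.integrable_cong) (auto simp: step)
  moreover have "expectation (Z (Suc n)) = expectation (\<lambda>\<omega>. Z n \<omega> + X \<omega> * g (W ?t \<omega> - W ?s \<omega>))"
    by (rule Bochner_Integration.integral_cong) (auto simp: step)
  ultimately show ?case using Suc XY by simp
qed

end

section \<open>The exit time from the wedge, capped at a horizon\<close>

context standard_brownian_motion
begin

text \<open>Only the traces of the exit time that the expectation argument uses are recorded: its
  position on a line unless it equals \<open>T\<close>, and that it equals \<open>T\<close> exactly
  on the event of no exit. Measurability is included because \<tau> will be picked path by
  path.\<close>

definition wedge_exit_time :: "real \<Rightarrow> real \<Rightarrow> real \<Rightarrow> real \<Rightarrow> real \<Rightarrow> ('a \<Rightarrow> real) \<Rightarrow> bool" where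
  "wedge_exit_time a1 b1 a2 b2 T \<tau> \<longleftrightarrow>
    \<tau> \<in> borel_measurable M \<and> (\<lambda>\<omega>. W (\<tau> \<omega>) \<omega>) \<in> borel_measurable M \<and>
    (\<forall>\<omega>\<in>space M. \<tau> \<omega> \<in> {0..T} \<and>
      - a1 * \<tau> \<omega> - b1 \<le> W (\<tau> \<omega>) \<omega> \<and> W (\<tau> \<omega>) \<omega> \<le> a2 * \<tau> \<omega> + b2 \<and>
      (\<tau> \<omega> = T \<longleftrightarrow> (\<forall>s\<in>{0..T}. - a1 * s - b1 \<le> W s \<omega> \<and> W s \<omega> \<le> a2 * s + b2)) \<and>
      (\<tau> \<omega> = T \<or> W (\<tau> \<omega>) \<omega> = - a1 * \<tau> \<omega> - b1 \<or> W (\<tau> \<omega>) \<omega> = a2 * \<tau> \<omega> + b2))"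

text \<open>The smaller of the two distances, \<open>v\<close>, reduces both barriers to a single
  continuous function. The same \<tau> has to serve every \<theta>, since the terms of Doob's series
  carry different parameters.\<close>

lemma wedge_exit_time_exists:
  fixes a1 b1 a2 b2 T :: real
  assumes pos: "a1 > 0" "b1 > 0" "a2 > 0" "b2 > 0" "T > 0"
  shows "\<exists>\<tau>. wedge_exit_time a1 b1 a2 b2 T \<tau> \<and>
    (\<forall>\<theta>. expectation (\<lambda>\<omega>. exp (\<theta> * W (\<tau> \<omega>) \<omega> - \<theta>\<^sup>2 * \<tau> \<omega> / 2)) = 1)"
proof -
  define v where "v \<omega> s = min (W s \<omega> + a1 * s + b1) (a2 * s + b2 - W s \<omega>)" for \<omega> s
  define t where "t m j = T * real j / real (Suc m)" for m j
  define stop where "stop \<omega> m = grid_stop (\<lambda>s. 0 \<le> v \<omega> s) (t m) (Suc m)" for \<omega> m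
  have v_iff: "0 \<le> v \<omega> s \<longleftrightarrow> - a1 * s - b1 \<le> W s \<omega> \<and> W s \<omega> \<le> a2 * s + b2" for \<omega> s
    by (auto simp: v_def)
  define good where "good \<omega> \<tau> \<longleftrightarrow> \<tau> \<in> {0..T} \<and> stop \<omega> \<longlonglongrightarrow> \<tau> \<and> (\<forall>s\<in>{0..\<tau>}. 0 \<le> v \<omega> s) \<and>
      ((\<forall>s\<in>{0..T}. 0 \<le> v \<omega> s) \<and> \<tau> = T \<or> \<not> (\<forall>s\<in>{0..T}. 0 \<le> v \<omega> s) \<and> \<tau> < T \<and> v \<omega> \<tau> = 0)"
    for \<omega> \<tau>
  have "\<exists>\<tau>. good \<omega> \<tau>" if \<omega>: "\<omega> \<in> space M" for \<omega>
  proof -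
    have cont: "continuous_on {0..} (v \<omega>)" unfolding v_def
      by (intro continuous_intros continuous_paths \<omega>)
    have v0: "v \<omega> 0 > 0" using pos by (simp add: v_def start_zero \<omega>)
    show ?thesis
    proof (rule grid_stop_converges[OF cont v0 pos(5)])
      fix \<tau> assume h: "\<tau> \<in> {0..T}" "\<And>s. s \<in> {0..\<tau>} \<Longrightarrow> 0 \<le> v \<omega> s"
        "(\<forall>s\<in>{0..T}. 0 \<le> v \<omega> s) \<and> \<tau> = T \<or> \<not> (\<forall>s\<in>{0..T}. 0 \<le> v \<omega> s) \<and> \<tau> < T \<and> v \<omega> \<tau> = 0"
        and "(\<lambda>m. grid_stop (\<lambda>s. 0 \<le> v \<omega> s) (\<lambda>j. T * real j / real (Suc m)) (Suc m)) \<longlonglongrightarrow> \<tau>"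
      then have "stop \<omega> \<longlonglongrightarrow> \<tau>" by (simp only: stop_def[abs_def] t_def[abs_def])
      then show ?thesis unfolding good_def by (intro exI[of _ \<tau>] conjI ballI h)
    qed
  qed
  then obtain \<tau> where "\<And>\<omega>. \<omega> \<in> space M \<Longrightarrow> good \<omega> (\<tau> \<omega>)" by metis
  then have \<tau>: "\<And>\<omega>. \<omega> \<in> space M \<Longrightarrow> \<tau> \<omega> \<in> {0..T}"
    and lim: "\<And>\<omega>. \<omega> \<in> space M \<Longrightarrow> stop \<omega> \<longlonglongrightarrow> \<tau> \<omega>"
    and inside: "\<And>\<omega> s. \<omega> \<in> space M \<Longrightarrow> s \<in> {0..\<tau> \<omega>} \<Longrightarrow> 0 \<le> v \<omega> s"
    and cases: "\<And>\<omega>. \<omega> \<in> space M \<Longrightarrow> (\<forall>s\<in>{0..T}. 0 \<le> v \<omega> s) \<and> \<tau> \<omega> = T \<or> \<not> (\<forall>s\<in>{0..T}. 0 \<le> v \<omega> s) \<and> \<tau> \<omega> < T \<and> v \<omega> (\<tau> \<omega>) = 0"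
    unfolding good_def by simp_all
  have t0: "0 \<le> t m i" "t m 0 = 0" "t m i < t m (Suc i)" for m i
    using pos(5) by (simp_all add: t_def divide_strict_right_mono)
  define I where "I m i = {- a1 * t m i - b1 .. a2 * t m i + b2}" for m i
  have Im: "I m i \<in> sets borel" for m i by (simp add: I_def)
  have Pv: "0 \<le> v \<omega> (t m i) \<longleftrightarrow> W (t m i) \<omega> \<in> I m i" for \<omega> m i by (auto simp: v_iff I_def)
  note meas = grid_stop_measurable[where I="I m" and t="t m" and P="\<lambda>\<omega> s. 0 \<le> v \<omega> s" and n="Suc m" for m,
      OF Im t0(1) Pv, folded stop_def]
  have stop_le: "0 \<le> stop \<omega> m" "stop \<omega> m \<le> T" for \<omega> m
  proof -
    obtain i where i: "i \<le> Suc m" "stop \<omega> m = t m i"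
      by (cases rule: grid_stop_cases[where P="\<lambda>s. 0 \<le> v \<omega> s" and t="t m" and n="Suc m"])
        (auto simp: stop_def intro: less_imp_le)
    have "t m i \<le> T" using i(1) pos(5) mult_left_mono[of "real i" "real (Suc m)" T]
      by (simp add: t_def field_simps)
    then show "0 \<le> stop \<omega> m" "stop \<omega> m \<le> T" using i t0(1)[of m i] by auto
  qed
  have limW: "(\<lambda>m. W (stop \<omega> m) \<omega>) \<longlonglongrightarrow> W (\<tau> \<omega>) \<omega>" if \<omega>: "\<omega> \<in> space M" for \<omega>
    by (rule continuous_on_tendsto_compose[OF continuous_paths[OF \<omega>] lim[OF \<omega>]])
      (use \<tau>[OF \<omega>] stop_le in auto)
  \<comment> \<open>\<tau> was chosen separately for each path; as the limit of the measurable grid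
    stops it is measurable all the same.\<close>
  have m1: "\<tau> \<in> borel_measurable M"
    by (rule borel_measurable_LIMSEQ_real[OF lim meas(1)])
  have m2: "(\<lambda>\<omega>. W (\<tau> \<omega>) \<omega>) \<in> borel_measurable M"
    by (rule borel_measurable_LIMSEQ_real[OF limW meas(2)])
  have Wle: "- a1 * \<tau> \<omega> - b1 \<le> W (\<tau> \<omega>) \<omega> \<and> W (\<tau> \<omega>) \<omega> \<le> a2 * \<tau> \<omega> + b2" if \<omega>: "\<omega> \<in> space M" for \<omega>
    using inside[OF \<omega>, of "\<tau> \<omega>"] \<tau>[OF \<omega>] by (simp add: v_iff)
  have bdry: "W (\<tau> \<omega>) \<omega> = - a1 * \<tau> \<omega> - b1 \<or> W (\<tau> \<omega>) \<omega> = a2 * \<tau> \<omega> + b2"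
    if "\<omega> \<in> space M" "\<tau> \<omega> \<noteq> T" for \<omega>
    using cases[OF that(1)] that(2) by (auto simp: v_def min_def split: if_splits)
  have E: "expectation (\<lambda>\<omega>. exp (\<theta> * W (\<tau> \<omega>) \<omega> - \<theta>\<^sup>2 * \<tau> \<omega> / 2)) = 1" for \<theta>
  proof -
    define Z where "Z \<theta> m \<omega> = exp (\<theta> * W (stop \<omega> m) \<omega> - \<theta>\<^sup>2 * stop \<omega> m / 2)" for \<theta> m \<omega>
    have Z: "integrable M (Z \<theta> m)" "expectation (Z \<theta> m) = 1" for \<theta> m
    proof -
      have "integrable M (Z \<theta> m) \<and> expectation (Z \<theta> m) = 1"
        unfolding Z_def stop_def
      proof (rule grid_stopped_exp[OF Im _ t0(2,3) Pv])
        fix i x assume "x \<in> I m i"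
        then show "\<bar>x\<bar> \<le> max (a1 * t m i + b1) (a2 * t m i + b2)" by (auto simp: I_def)
      qed
      then show "integrable M (Z \<theta> m)" "expectation (Z \<theta> m) = 1" by auto
    qed
    \<comment> \<open>Up to a bounded factor, the square is the exponential martingale with parameter \<open>2 * \<theta>\<close>,
      so the overshoot at the grid points is controlled in \<open>L\<^sup>2\<close>.\<close>
    have sq: "(Z \<theta> m \<omega>)\<^sup>2 = exp (\<theta>\<^sup>2 * stop \<omega> m) * Z (2 * \<theta>) m \<omega>" for m \<omega>
      by (simp add: Z_def power2_eq_square algebra_simps flip: exp_add)
    have sq_le: "(Z \<theta> m \<omega>)\<^sup>2 \<le> exp (\<theta>\<^sup>2 * T) * Z (2 * \<theta>) m \<omega>" for m \<omega>
      unfolding sq using stop_le(2)[of \<omega> m] by (intro mult_right_mono) (auto simp: Z_def mult_left_mono)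
    have sq_int: "integrable M (\<lambda>\<omega>. (Z \<theta> m \<omega>)\<^sup>2)" for m
    proof (rule Bochner_Integration.integrable_bound)
      show "integrable M (\<lambda>\<omega>. exp (\<theta>\<^sup>2 * T) * Z (2 * \<theta>) m \<omega>)" using Z by simp
      show "(\<lambda>\<omega>. (Z \<theta> m \<omega>)\<^sup>2) \<in> borel_measurable M"
        using borel_measurable_integrable[OF Z(1)] by measurable
      show "AE \<omega> in M. norm ((Z \<theta> m \<omega>)\<^sup>2) \<le> norm (exp (\<theta>\<^sup>2 * T) * Z (2 * \<theta>) m \<omega>)"
        using sq_le by (auto simp: Z_def)
    qed
    show ?thesis
    \<comment> \<open>\<open>C\<close> comes from the expectation 1 at the doubled parameter.
      \<open>B\<close> bounds the limit only: at time \<tau> the path is still in the wedge, and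
      \<tau> is at most \<open>T\<close>.\<close>
    proof (rule expectation_limit_square_bounded[where Z="Z \<theta>" and C="exp (\<theta>\<^sup>2 * T)" and B="exp (\<bar>\<theta>\<bar> * (a1 * T + b1 + a2 * T + b2))"])
      show "expectation (\<lambda>\<omega>. (Z \<theta> m \<omega>)\<^sup>2) \<le> exp (\<theta>\<^sup>2 * T)" for m
      proof -
        have "expectation (\<lambda>\<omega>. (Z \<theta> m \<omega>)\<^sup>2) \<le> expectation (\<lambda>\<omega>. exp (\<theta>\<^sup>2 * T) * Z (2 * \<theta>) m \<omega>)"
          by (intro integral_mono sq_int sq_le) (use Z in simp)
        then show ?thesis using Z by simp
      qed
      fix \<omega> assume \<omega>: "\<omega> \<in> space M"
      show "(\<lambda>m. Z \<theta> m \<omega>) \<longlonglongrightarrow> exp (\<theta> * W (\<tau> \<omega>) \<omega> - \<theta>\<^sup>2 * \<tau> \<omega> / 2)"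
        unfolding Z_def by (intro tendsto_intros limW lim \<omega>) auto
      have "\<bar>W (\<tau> \<omega>) \<omega>\<bar> \<le> a1 * T + b1 + a2 * T + b2"
      proof -
        have "a1 * \<tau> \<omega> \<le> a1 * T" "a2 * \<tau> \<omega> \<le> a2 * T" "0 \<le> a1 * T" "0 \<le> a2 * T"
          using \<tau>[OF \<omega>] pos by auto
        then show ?thesis using Wle[OF \<omega>] pos by linarith
      qed
      then have "\<bar>\<theta>\<bar> * \<bar>W (\<tau> \<omega>) \<omega>\<bar> \<le> \<bar>\<theta>\<bar> * (a1 * T + b1 + a2 * T + b2)"
        by (intro mult_left_mono) auto
      moreover have "\<theta> * W (\<tau> \<omega>) \<omega> \<le> \<bar>\<theta>\<bar> * \<bar>W (\<tau> \<omega>) \<omega>\<bar>" by (metis abs_ge_self abs_mult)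
      moreover have "0 \<le> \<theta>\<^sup>2 * \<tau> \<omega> / 2" using \<tau>[OF \<omega>] by simp
      ultimately show "exp (\<theta> * W (\<tau> \<omega>) \<omega> - \<theta>\<^sup>2 * \<tau> \<omega> / 2) \<le> exp (\<bar>\<theta>\<bar> * (a1 * T + b1 + a2 * T + b2))"
        by simp
    qed (use Z sq_int in \<open>auto simp: Z_def\<close>)
  qed
  have stay: "\<tau> \<omega> = T \<longleftrightarrow> (\<forall>s\<in>{0..T}. - a1 * s - b1 \<le> W s \<omega> \<and> W s \<omega> \<le> a2 * s + b2)"
    if "\<omega> \<in> space M" for \<omega>
    using cases[OF that] unfolding v_iff by auto
  have "wedge_exit_time a1 b1 a2 b2 T \<tau>"
    unfolding wedge_exit_time_def
  proof (intro conjI ballI m1 m2)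
    fix \<omega> assume \<omega>: "\<omega> \<in> space M"
    show "\<tau> \<omega> = T \<or> W (\<tau> \<omega>) \<omega> = - a1 * \<tau> \<omega> - b1 \<or> W (\<tau> \<omega>) \<omega> = a2 * \<tau> \<omega> + b2"
      using bdry[OF \<omega>] by blast
  qed (use \<tau> Wle stay in blast)+
  then show ?thesis using E by blast
qed

end

subsection \<open>Doob's series\<close>

text \<open>Doob's formula has four families of exponents indexed by positive integers.
  Two of them are obtained from the other two by \<open>n \<mapsto> - n\<close> and \<open>n \<mapsto> 1 - n\<close>, so over
  all integers only two remain; the summand \<open>1\<close> is the term \<open>n = 0\<close> of the first.
  The arguments \<open>u\<close> and \<open>v\<close> are the distances to the lower and the upper line.\<close>

definition doob_exponent1 :: "real \<Rightarrow> real \<Rightarrow> real \<Rightarrow> real \<Rightarrow> int \<Rightarrow> real" where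
  "doob_exponent1 a1 a2 u v n = of_int (n\<^sup>2) * (a1 * u + a2 * v) + of_int (n * (n - 1)) * (a2 * u) + of_int (n * (n + 1)) * (a1 * v)"

definition doob_exponent2 :: "real \<Rightarrow> real \<Rightarrow> real \<Rightarrow> real \<Rightarrow> int \<Rightarrow> real" where
  "doob_exponent2 a1 a2 u v n = of_int (n\<^sup>2) * (a2 * v) + of_int ((n - 1)\<^sup>2) * (a1 * u) + of_int (n * (n - 1)) * (a1 * v + a2 * u)"

definition doob_term :: "real \<Rightarrow> real \<Rightarrow> real \<Rightarrow> real \<Rightarrow> int \<Rightarrow> real" where
  "doob_term a1 a2 u v n = exp (- 2 * doob_exponent1 a1 a2 u v n) - exp (- 2 * doob_exponent2 a1 a2 u v n)"

lemma int_mult_pred_nonneg: "0 \<le> n * (n - 1)" "0 \<le> n * (n + 1)" for n :: int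
  by (cases "n \<le> 0"; auto simp: zero_le_mult_iff)+

lemma doob_exponent_nonneg:
  assumes "a1 > 0" "a2 > 0" "u \<ge> 0" "v \<ge> 0"
  shows "0 \<le> doob_exponent1 a1 a2 u v n" "0 \<le> doob_exponent2 a1 a2 u v n"
  unfolding doob_exponent1_def doob_exponent2_def
  by (intro add_nonneg_nonneg mult_nonneg_nonneg; use assms int_mult_pred_nonneg in \<open>simp del: of_int_mult of_int_add of_int_diff\<close>)+

text \<open>Each integer coefficient is at least \<open>n^2 - 2 * |n|\<close>, and the four products
  they multiply add up to \<open>(a1 + a2) * (u + v)\<close>. Thus the quadratic growth in n depends
  on \<open>u + v\<close> alone and survives when \<open>u\<close> or \<open>v\<close> is 0.\<close>

lemma doob_exponent_ge:
  assumes "a1 > 0" "a2 > 0" "u \<ge> 0" "v \<ge> 0"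
  shows "(a1 + a2) * (u + v) * of_int (n\<^sup>2 - 2 * \<bar>n\<bar>) \<le> doob_exponent1 a1 a2 u v n"
    "(a1 + a2) * (u + v) * of_int (n\<^sup>2 - 2 * \<bar>n\<bar>) \<le> doob_exponent2 a1 a2 u v n"
proof -
  have le: "n\<^sup>2 - 2 * \<bar>n\<bar> \<le> n\<^sup>2" "n\<^sup>2 - 2 * \<bar>n\<bar> \<le> (n - 1)\<^sup>2" "n\<^sup>2 - 2 * \<bar>n\<bar> \<le> n * (n - 1)" "n\<^sup>2 - 2 * \<bar>n\<bar> \<le> n * (n + 1)"
    by (auto simp: power2_eq_square algebra_simps abs_if)
  have split: "(a1 + a2) * (u + v) * r = r * (a1 * u + a2 * v) + r * (a2 * u) + r * (a1 * v)"
    "(a1 + a2) * (u + v) * r = r * (a2 * v) + r * (a1 * u) + r * (a1 * v + a2 * u)" for r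
    by (simp_all add: algebra_simps)
  show "(a1 + a2) * (u + v) * of_int (n\<^sup>2 - 2 * \<bar>n\<bar>) \<le> doob_exponent1 a1 a2 u v n"
    unfolding split(1) doob_exponent1_def
    by (intro add_mono mult_right_mono; use assms le in \<open>simp only: of_int_le_iff | simp\<close>)
  show "(a1 + a2) * (u + v) * of_int (n\<^sup>2 - 2 * \<bar>n\<bar>) \<le> doob_exponent2 a1 a2 u v n"
    unfolding split(2) doob_exponent2_def
    by (intro add_mono mult_right_mono; use assms le in \<open>simp only: of_int_le_iff | simp\<close>)
qed

definition doob_majorant :: "real \<Rightarrow> int \<Rightarrow> real" where
  "doob_majorant q n = exp (4 * q * \<bar>of_int n\<bar> - 2 * q * (of_int n)\<^sup>2)"

lemma doob_majorant_summable: "q > 0 \<Longrightarrow> doob_majorant q summable_on UNIV"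
  using summable_on_exp_linear_minus_square[of "2 * q" "4 * q"] by (simp add: doob_majorant_def[abs_def])

text \<open>Lowering the rate from \<open>Q\<close> to \<open>q\<close> weakens the bound only where
  \<open>n^2 - 2 * |n|\<close> is nonnegative. It is negative at \<open>n = 1\<close> and
  \<open>n = -1\<close>, where nonnegativity of \<open>e\<close> takes over.\<close>

lemma exp_le_doob_majorant:
  assumes "0 \<le> e" "Q * of_int (n\<^sup>2 - 2 * \<bar>n\<bar>) \<le> e" "q \<le> Q" "0 \<le> q"
  shows "exp (- 2 * e) \<le> doob_majorant q n"
proof -
  have "q * of_int (n\<^sup>2 - 2 * \<bar>n\<bar>) \<le> e"
  proof (cases "0 \<le> n\<^sup>2 - 2 * \<bar>n\<bar>")
    case True
    then have "q * real_of_int (n\<^sup>2 - 2 * \<bar>n\<bar>) \<le> Q * real_of_int (n\<^sup>2 - 2 * \<bar>n\<bar>)"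
      by (intro mult_right_mono assms) (simp only: of_int_0_le_iff)
    then show ?thesis using assms(2) by linarith
  next
    case False
    then have "real_of_int (n\<^sup>2 - 2 * \<bar>n\<bar>) \<le> 0" by (simp only: of_int_le_0_iff)
    then show ?thesis using assms(1,4) by (meson mult_nonneg_nonpos order_trans)
  qed
  then show ?thesis by (simp add: doob_majorant_def algebra_simps)
qed

lemma exp_doob_exponent_le:
  assumes "a1 > 0" "a2 > 0" "u \<ge> 0" "v \<ge> 0" "r \<le> u + v" "0 \<le> r"
  shows "exp (- 2 * doob_exponent1 a1 a2 u v n) \<le> doob_majorant ((a1 + a2) * r) n"
    "exp (- 2 * doob_exponent2 a1 a2 u v n) \<le> doob_majorant ((a1 + a2) * r) n"
  by (rule exp_le_doob_majorant[OF _ doob_exponent_ge(1)] exp_le_doob_majorant[OF _ doob_exponent_ge(2)];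
      use assms doob_exponent_nonneg in \<open>simp add: mult_left_mono\<close>)+

lemma abs_doob_term_le:
  assumes "a1 > 0" "a2 > 0" "u \<ge> 0" "v \<ge> 0" "r \<le> u + v" "0 \<le> r"
  shows "\<bar>doob_term a1 a2 u v n\<bar> \<le> doob_majorant ((a1 + a2) * r) n"
  using exp_doob_exponent_le[OF assms, of n] exp_gt_zero[of "- 2 * doob_exponent1 a1 a2 u v n"]
    exp_gt_zero[of "- 2 * doob_exponent2 a1 a2 u v n"]
  unfolding doob_term_def by linarith

lemma exp_doob_exponent_summable:
  assumes "a1 > 0" "a2 > 0" "u \<ge> 0" "v \<ge> 0" "u + v > 0"
  shows "(\<lambda>n. exp (- 2 * doob_exponent1 a1 a2 u v n)) summable_on UNIV"
    "(\<lambda>n. exp (- 2 * doob_exponent2 a1 a2 u v n)) summable_on UNIV"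
  using assms
  by (intro summable_on_comparison_test[OF doob_majorant_summable[of "(a1 + a2) * (u + v)"]]
      exp_doob_exponent_le; simp)+

text \<open>On the lower line the second exponent at \<open>n\<close> is the first one at
  \<open>- n\<close>, on the upper line the first one at \<open>1 - n\<close>. Both families are
  summable separately, so they may be rearranged before subtracting.\<close>

lemma doob_sum_boundary:
  assumes "a1 > 0" "a2 > 0" "u \<ge> 0" "v \<ge> 0" "u + v > 0" "u = 0 \<or> v = 0"
  shows "infsum (doob_term a1 a2 u v) UNIV = 0"
proof -
  have "infsum (doob_term a1 a2 u v) UNIV =
      infsum (\<lambda>n. exp (- 2 * doob_exponent1 a1 a2 u v n) + - exp (- 2 * doob_exponent2 a1 a2 u v n)) UNIV"
    by (simp add: doob_term_def[abs_def])
  also have "\<dots> = infsum (\<lambda>n. exp (- 2 * doob_exponent1 a1 a2 u v n)) UNIV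
      - infsum (\<lambda>n. exp (- 2 * doob_exponent2 a1 a2 u v n)) UNIV"
    using exp_doob_exponent_summable[OF assms(1-5)]
    by (subst infsum_add) (auto simp: infsum_uminus summable_on_uminus)
  also have "infsum (\<lambda>n. exp (- 2 * doob_exponent1 a1 a2 u v n)) UNIV =
      infsum (\<lambda>n. exp (- 2 * doob_exponent2 a1 a2 u v n)) UNIV"
    using assms(6)
  proof
    assume "u = 0"
    then show ?thesis
      by (intro infsum_reindex_bij_witness[of _ uminus uminus])
        (auto simp: doob_exponent1_def doob_exponent2_def power2_eq_square algebra_simps)
  next
    assume "v = 0"
    then show ?thesis
      by (intro infsum_reindex_bij_witness[of _ "\<lambda>n. 1 - n" "\<lambda>n. 1 - n"])
        (auto simp: doob_exponent1_def doob_exponent2_def power2_eq_square algebra_simps)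
  qed
  finally show ?thesis by simp
qed

text \<open>The exponents are linear in the two distances, hence in \<open>x\<close> and
  \<open>t\<close>. Their coefficients are so arranged that the one of \<open>t\<close> is minus
  half the square of the one of \<open>x\<close>, which is precisely the exponential martingale
  relation.\<close>

lemma exp_doob_exponent_shift:
  fixes a1 a2 u v t x :: real and n :: int
  defines "\<theta>1 \<equiv> 2 * of_int n * (a1 + a2)" and "\<theta>2 \<equiv> 2 * (of_int n * a2 + of_int (n - 1) * a1)"
  shows "exp (- 2 * doob_exponent1 a1 a2 (u + a1 * t + x) (v + a2 * t - x) n) =
      exp (- 2 * doob_exponent1 a1 a2 u v n) * exp (\<theta>1 * x - \<theta>1\<^sup>2 * t / 2)"
    "exp (- 2 * doob_exponent2 a1 a2 (u + a1 * t + x) (v + a2 * t - x) n) =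
      exp (- 2 * doob_exponent2 a1 a2 u v n) * exp (\<theta>2 * x - \<theta>2\<^sup>2 * t / 2)"
  unfolding exp_add[symmetric] exp_inj_iff assms doob_exponent1_def doob_exponent2_def
  by (simp_all add: power2_eq_square) algebra+

text \<open>The first family contributes exactly 1 at \<open>n = 0\<close>. Every other exponent is
  at least \<open>B\<close> times its value at \<open>u = v = 1\<close>, and that value is at least
  \<open>?\<kappa>\<close>. Spending \<open>B - 1\<close> of these copies on the small factor leaves
  one copy for a summable majorant; the 2 in it is \<open>u + v\<close> for
  \<open>u = v = 1\<close>.\<close>

lemma doob_sum_near_1:
  assumes a: "a1 > 0" "a2 > 0" and B: "1 \<le> B" "B \<le> u" "B \<le> v"
  shows "\<bar>infsum (doob_term a1 a2 u v) UNIV - 1\<bar> \<le>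
    exp (- 2 * (B - 1) * min a1 a2) * infsum (doob_majorant ((a1 + a2) * 2)) UNIV"
proof -
  let ?\<kappa> = "min a1 a2" and ?g = "doob_majorant ((a1 + a2) * 2)"
  let ?K = "exp (- 2 * (B - 1) * ?\<kappa>)"
  have key: "exp (- 2 * e) \<le> ?K * ?g n"
    if "B * e1 \<le> e" "?\<kappa> \<le> e1" "exp (- 2 * e1) \<le> ?g n" for e1 e n
  proof -
    have "(B - 1) * ?\<kappa> + e1 \<le> e" using mult_left_mono[OF that(2), of "B - 1"] B that(1) by (simp add: algebra_simps)
    then have "- 2 * e \<le> - 2 * (B - 1) * ?\<kappa> + - 2 * e1"
      by (simp only: mult.assoc)
    then have "exp (- 2 * e) \<le> exp (- 2 * (B - 1) * ?\<kappa> + - 2 * e1)"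
      by (simp only: exp_le_cancel_iff)
    also have "\<dots> = ?K * exp (- 2 * e1)" by (rule exp_add)
    also have "\<dots> \<le> ?K * ?g n" using that(3) by (intro mult_left_mono) auto
    finally show ?thesis .
  qed
  have mono1: "B * doob_exponent1 a1 a2 1 1 n \<le> doob_exponent1 a1 a2 u v n" for n
  proof -
    have "B * doob_exponent1 a1 a2 1 1 n = doob_exponent1 a1 a2 B B n"
      by (simp add: doob_exponent1_def algebra_simps)
    also have "\<dots> \<le> doob_exponent1 a1 a2 u v n"
      unfolding doob_exponent1_def using a B int_mult_pred_nonneg[of n]
      by (intro add_mono mult_left_mono) (simp_all del: of_int_mult of_int_add of_int_diff)
    finally show ?thesis .
  qed
  have mono2: "B * doob_exponent2 a1 a2 1 1 n \<le> doob_exponent2 a1 a2 u v n" for n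
  proof -
    have "B * doob_exponent2 a1 a2 1 1 n = doob_exponent2 a1 a2 B B n"
      by (simp add: doob_exponent2_def algebra_simps)
    also have "\<dots> \<le> doob_exponent2 a1 a2 u v n"
      unfolding doob_exponent2_def using a B int_mult_pred_nonneg[of n]
      by (intro add_mono mult_left_mono) (simp_all del: of_int_mult of_int_add of_int_diff)
    finally show ?thesis .
  qed
  have ge1: "?\<kappa> \<le> doob_exponent1 a1 a2 1 1 n" if "n \<noteq> 0" for n
  proof -
    have "1 \<le> n\<^sup>2" using that by (metis int_one_le_iff_zero_less zero_less_power2)
    then have n2: "1 \<le> real_of_int (n\<^sup>2)" by (simp only: of_int_1_le_iff)
    have "?\<kappa> \<le> 1 * (a1 * 1 + a2 * 1)" using a by (simp add: min_def)
    also have "\<dots> \<le> real_of_int (n\<^sup>2) * (a1 * 1 + a2 * 1)"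
      using a by (intro mult_right_mono n2) simp
    finally have 1: "?\<kappa> \<le> real_of_int (n\<^sup>2) * (a1 * 1 + a2 * 1)" .
    have 0: "0 \<le> real_of_int (n * (n - 1)) * (a2 * 1)" "0 \<le> real_of_int (n * (n + 1)) * (a1 * 1)"
      using a int_mult_pred_nonneg[of n] by (intro mult_nonneg_nonneg; simp del: of_int_mult of_int_add of_int_diff)+
    from add_mono[OF add_mono[OF 1 0(1)] 0(2)] show ?thesis unfolding doob_exponent1_def by simp
  qed
  \<comment> \<open>Index 0 is included here: the second exponent is \<open>a1\<close> there, not 0,
    so the second family has no surviving term.\<close>
  have ge2: "?\<kappa> \<le> doob_exponent2 a1 a2 1 1 n" for n
  proof -
    have 0: "0 \<le> real_of_int (n * (n - 1)) * (a1 * 1 + a2 * 1)"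
      "0 \<le> real_of_int (n\<^sup>2) * (a2 * 1)" "0 \<le> real_of_int ((n - 1)\<^sup>2) * (a1 * 1)"
      using a int_mult_pred_nonneg[of n] by (intro mult_nonneg_nonneg; simp del: of_int_mult of_int_add of_int_diff)+
    show ?thesis
    proof (cases "n = 0")
      case True
      then show ?thesis by (simp add: doob_exponent2_def)
    next
      case False
      then have "1 \<le> n\<^sup>2" by (metis int_one_le_iff_zero_less zero_less_power2)
      then have n2: "1 \<le> real_of_int (n\<^sup>2)" by (simp only: of_int_1_le_iff)
      have "?\<kappa> \<le> 1 * (a2 * 1)" by simp
      also have "\<dots> \<le> real_of_int (n\<^sup>2) * (a2 * 1)" using a by (intro mult_right_mono n2) simp
      finally have 1: "?\<kappa> \<le> real_of_int (n\<^sup>2) * (a2 * 1)" .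
      from add_mono[OF add_mono[OF 1 0(3)] 0(1)] show ?thesis unfolding doob_exponent2_def by simp
    qed
  qed
  have g: "exp (- 2 * doob_exponent1 a1 a2 1 1 n) \<le> ?g n" "exp (- 2 * doob_exponent2 a1 a2 1 1 n) \<le> ?g n" for n
    using exp_doob_exponent_le[OF a, of 1 1 2 n] by auto
  have bound: "\<bar>doob_term a1 a2 u v n - of_bool (n = 0)\<bar> \<le> ?K * ?g n" for n
  proof (cases "n = 0")
    case True
    then have "doob_exponent1 a1 a2 u v n = 0" by (simp add: doob_exponent1_def)
    then show ?thesis using key[OF mono2 ge2 g(2)[of n]] True by (simp add: doob_term_def)
  next
    case False
    show ?thesis
      using key[OF mono2 ge2 g(2)[of n]] key[OF mono1 ge1[OF False] g(1)] False
        exp_gt_zero[of "- 2 * doob_exponent1 a1 a2 u v n"] exp_gt_zero[of "- 2 * doob_exponent2 a1 a2 u v n"]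
      unfolding doob_term_def by (simp add: abs_le_iff del: exp_gt_zero)
  qed
  have gs: "?g summable_on UNIV" using a by (intro doob_majorant_summable) simp
  have ds: "doob_term a1 a2 u v summable_on UNIV"
    by (rule abs_summable_summable, rule summable_on_comparison_test[OF doob_majorant_summable[of "(a1 + a2) * (u + v)"]])
      (use a B in \<open>auto intro!: abs_doob_term_le\<close>)
  have one: "((\<lambda>n::int. of_bool (n = 0)) has_sum (1::real)) UNIV"
    by (rule has_sum_finite_neutralI[of "{0}"]) auto
  have "((\<lambda>n. doob_term a1 a2 u v n + - of_bool (n = 0)) has_sum (infsum (doob_term a1 a2 u v) UNIV + - 1)) UNIV"
    using has_sum_infsum[OF ds] one by (intro has_sum_add) (auto simp: has_sum_uminus)
  moreover have "((\<lambda>n. ?K * ?g n) has_sum (?K * infsum ?g UNIV)) UNIV"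
    using gs by (intro has_sum_cmult_right) simp
  ultimately have "norm (infsum (doob_term a1 a2 u v) UNIV + - 1) \<le> ?K * infsum ?g UNIV"
    by (rule norm_infsum_le) (use bound in simp)
  then show ?thesis by simp
qed

section \<open>The wedge probability as the value of Doob's series\<close>

context standard_brownian_motion
begin

text \<open>Each term keeps its expectation at the exit time, and the majorant from
  \<open>U + V >= b1 + b2\<close> allows summation over n. Paths that have left are on a line, where
  the sum is 0, so only the event \<open>stay\<close> contributes, and there the exit time is
  \<open>T\<close>.\<close>

lemma doob_sum_expectation:
  fixes a1 b1 a2 b2 T :: real
  assumes pos: "a1 > 0" "b1 > 0" "a2 > 0" "b2 > 0" "T > 0"
  defines "stay \<equiv> {\<omega> \<in> space M. \<forall>s\<in>{0..T}. - a1 * s - b1 \<le> W s \<omega> \<and> W s \<omega> \<le> a2 * s + b2}"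
    and "H \<equiv> \<lambda>u v. infsum (doob_term a1 a2 u v) UNIV"
  shows "stay \<in> sets M"
    and "integrable M (\<lambda>\<omega>. indicator stay \<omega> * H (b1 + a1 * T + W T \<omega>) (b2 + a2 * T - W T \<omega>))"
    and "expectation (\<lambda>\<omega>. indicator stay \<omega> * H (b1 + a1 * T + W T \<omega>) (b2 + a2 * T - W T \<omega>)) = H b1 b2"
proof -
  obtain \<tau> where "wedge_exit_time a1 b1 a2 b2 T \<tau> \<and>
      (\<forall>\<theta>. expectation (\<lambda>\<omega>. exp (\<theta> * W (\<tau> \<omega>) \<omega> - \<theta>\<^sup>2 * \<tau> \<omega> / 2)) = 1)"
    using wedge_exit_time_exists[OF pos] ..
  then have ex: "wedge_exit_time a1 b1 a2 b2 T \<tau>"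
    and E: "\<And>\<theta>. expectation (\<lambda>\<omega>. exp (\<theta> * W (\<tau> \<omega>) \<omega> - \<theta>\<^sup>2 * \<tau> \<omega> / 2)) = 1"
    by simp_all
  note ex = ex[unfolded wedge_exit_time_def]
  have m[measurable]: "\<tau> \<in> borel_measurable M" "(\<lambda>\<omega>. W (\<tau> \<omega>) \<omega>) \<in> borel_measurable M"
    using ex by blast+
  have \<tau>: "\<tau> \<omega> \<in> {0..T}"
    and inside: "- a1 * \<tau> \<omega> - b1 \<le> W (\<tau> \<omega>) \<omega> \<and> W (\<tau> \<omega>) \<omega> \<le> a2 * \<tau> \<omega> + b2"
    and stay: "\<tau> \<omega> = T \<longleftrightarrow> (\<forall>s\<in>{0..T}. - a1 * s - b1 \<le> W s \<omega> \<and> W s \<omega> \<le> a2 * s + b2)"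
    and bdry: "\<tau> \<omega> \<noteq> T \<Longrightarrow> W (\<tau> \<omega>) \<omega> = - a1 * \<tau> \<omega> - b1 \<or> W (\<tau> \<omega>) \<omega> = a2 * \<tau> \<omega> + b2"
    if "\<omega> \<in> space M" for \<omega>
    using ex that by blast+
  have stay_eq: "stay = {\<omega> \<in> space M. \<tau> \<omega> = T}"
    unfolding stay_def using stay by blast
  show stay_sets: "stay \<in> sets M" unfolding stay_eq by measurable
  define U where "U \<omega> = b1 + a1 * \<tau> \<omega> + W (\<tau> \<omega>) \<omega>" for \<omega>
  define V where "V \<omega> = b2 + a2 * \<tau> \<omega> - W (\<tau> \<omega>) \<omega>" for \<omega>
  have UV: "0 \<le> U \<omega>" "0 \<le> V \<omega>" "b1 + b2 \<le> U \<omega> + V \<omega>" if "\<omega> \<in> space M" for \<omega>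
    using inside[OF that] \<tau>[OF that] pos by (auto simp: U_def V_def)
  \<comment> \<open>A function that is not integrable has integral 0 by convention, so expectation 1
    already forces integrability.\<close>
  have Ei: "integrable M (\<lambda>\<omega>. exp (\<theta> * W (\<tau> \<omega>) \<omega> - \<theta>\<^sup>2 * \<tau> \<omega> / 2))" for \<theta>
    using E[of \<theta>] not_integrable_integral_eq by fastforce
  have doob_E: "integrable M (\<lambda>\<omega>. doob_term a1 a2 (U \<omega>) (V \<omega>) n)"
    "expectation (\<lambda>\<omega>. doob_term a1 a2 (U \<omega>) (V \<omega>) n) = doob_term a1 a2 b1 b2 n" for n
    unfolding doob_term_def U_def V_def exp_doob_exponent_shift by (simp_all add: Ei E)
  let ?g = "doob_majorant ((a1 + a2) * (b1 + b2))"
  have gs: "?g summable_on UNIV" using pos by (intro doob_majorant_summable) simp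
  have le: "\<bar>doob_term a1 a2 (U \<omega>) (V \<omega>) n\<bar> \<le> ?g n" if "\<omega> \<in> space M" for \<omega> n
    using UV[OF that] pos by (intro abs_doob_term_le) auto
  have le0: "\<bar>doob_term a1 a2 b1 b2 n\<bar> \<le> ?g n" for n
    using pos by (intro abs_doob_term_le) auto
  have summ: "f summable_on UNIV" if "\<And>n. \<bar>f n\<bar> \<le> ?g n" for f :: "int \<Rightarrow> real"
    by (rule abs_summable_summable, rule summable_on_comparison_test[OF gs]) (use that in auto)
  define S where "S N \<omega> = (\<Sum>n\<in>{- int N..<int N}. doob_term a1 a2 (U \<omega>) (V \<omega>) n)" for N \<omega>
  have lim: "(\<lambda>N. \<Sum>n\<in>{- int N..<int N}. f n) \<longlonglongrightarrow> infsum f UNIV" if "f summable_on UNIV" for f :: "int \<Rightarrow> real"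
    by (rule filterlim_compose[OF infsum_tendsto[OF that] filterlim_int_intervals])
  have S_int: "integrable M (S N)" "expectation (S N) = (\<Sum>n\<in>{- int N..<int N}. doob_term a1 a2 b1 b2 n)" for N
    unfolding S_def by (simp_all add: doob_E)
  have HM: "(\<lambda>\<omega>. H (U \<omega>) (V \<omega>)) \<in> borel_measurable M"
    and SH: "\<And>\<omega>. \<omega> \<in> space M \<Longrightarrow> (\<lambda>N. S N \<omega>) \<longlonglongrightarrow> H (U \<omega>) (V \<omega>)"
  proof -
    show *: "(\<lambda>N. S N \<omega>) \<longlonglongrightarrow> H (U \<omega>) (V \<omega>)" if "\<omega> \<in> space M" for \<omega>
      unfolding S_def H_def by (intro lim summ le that)
    show "(\<lambda>\<omega>. H (U \<omega>) (V \<omega>)) \<in> borel_measurable M"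
      by (rule borel_measurable_LIMSEQ_real[OF *]) (use S_int in auto)
  qed
  have S_le: "norm (S N \<omega>) \<le> infsum ?g UNIV" if "\<omega> \<in> space M" for N \<omega>
  proof -
    have "norm (S N \<omega>) \<le> (\<Sum>n\<in>{- int N..<int N}. ?g n)"
      unfolding S_def by (intro sum_norm_le) (use le that in auto)
    also have "\<dots> \<le> infsum ?g UNIV"
      by (intro finite_sum_le_infsum gs) (auto simp: doob_majorant_def)
    finally show ?thesis .
  qed
  have S_meas: "S N \<in> borel_measurable M" for N
    using S_int(1) by (rule borel_measurable_integrable)
  have AE_lim: "AE \<omega> in M. (\<lambda>N. S N \<omega>) \<longlonglongrightarrow> H (U \<omega>) (V \<omega>)" by (intro AE_I2 SH)
  have AE_le: "AE \<omega> in M. norm (S N \<omega>) \<le> infsum ?g UNIV" for N by (intro AE_I2 S_le)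
  have const: "integrable M (\<lambda>_. infsum ?g UNIV)" by simp
  have main_int: "integrable M (\<lambda>\<omega>. H (U \<omega>) (V \<omega>))"
    by (rule integrable_dominated_convergence[OF HM S_meas const AE_lim AE_le])
  have "(\<lambda>N. expectation (S N)) \<longlonglongrightarrow> expectation (\<lambda>\<omega>. H (U \<omega>) (V \<omega>))"
    by (rule integral_dominated_convergence[OF HM S_meas const AE_lim AE_le])
  moreover have "(\<lambda>N. expectation (S N)) \<longlonglongrightarrow> H b1 b2"
    unfolding S_int(2) H_def by (intro lim summ le0)
  ultimately have main: "expectation (\<lambda>\<omega>. H (U \<omega>) (V \<omega>)) = H b1 b2"
    by (rule LIMSEQ_unique)
  have eq: "H (U \<omega>) (V \<omega>) = indicator stay \<omega> * H (b1 + a1 * T + W T \<omega>) (b2 + a2 * T - W T \<omega>)"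
    if \<omega>: "\<omega> \<in> space M" for \<omega>
  proof (cases "\<tau> \<omega> = T")
    case True
    then show ?thesis using \<omega> by (simp add: stay_eq U_def V_def)
  next
    case False
    then have "U \<omega> = 0 \<or> V \<omega> = 0" using bdry[OF \<omega> False] by (auto simp: U_def V_def)
    then have "H (U \<omega>) (V \<omega>) = 0"
      unfolding H_def using UV[OF \<omega>] pos by (intro doob_sum_boundary) auto
    then show ?thesis using False by (simp add: stay_eq)
  qed
  show "integrable M (\<lambda>\<omega>. indicator stay \<omega> * H (b1 + a1 * T + W T \<omega>) (b2 + a2 * T - W T \<omega>))"
    using main_int Bochner_Integration.integrable_cong[OF refl eq] by (rule iffD1[rotated])
  show "expectation (\<lambda>\<omega>. indicator stay \<omega> * H (b1 + a1 * T + W T \<omega>) (b2 + a2 * T - W T \<omega>)) = H b1 b2"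
    using Bochner_Integration.integral_cong[OF refl eq] main by (rule trans[OF sym])
qed

lemma prob_abs_W_ge:
  assumes "T > 0" "r > 0"
  shows "prob {\<omega> \<in> space M. \<bar>W T \<omega>\<bar> \<ge> r} \<le> T / r\<^sup>2"
proof -
  have sq: "sqrt T > 0" using assms by simp
  have D: "distributed M lborel (\<lambda>\<omega>. W T \<omega> - W 0 \<omega>) (normal_density 0 (sqrt T))"
    using normal_increments[of 0 T] assms by simp
  let ?X = "\<lambda>\<omega>. W T \<omega> - W 0 \<omega>"
  have [measurable]: "W T \<in> borel_measurable M" "W 0 \<in> borel_measurable M" using W_measurable assms by auto
  have mean: "expectation ?X = 0" by (rule normal_distributed_expectation[OF sq D])
  have var: "variance ?X = T" using normal_distributed_variance[OF sq D] assms by simp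
  have "integrable lborel (\<lambda>x. normal_density 0 (sqrt T) x * x\<^sup>2)"
    using integrable_normal_moment[OF sq, of 0 2] by simp
  then have int: "integrable M (\<lambda>\<omega>. (?X \<omega>)\<^sup>2)"
    using distributed_integrable[OF D, of "\<lambda>x. x\<^sup>2"] sq by simp
  have "prob {\<omega> \<in> space M. \<bar>W T \<omega>\<bar> \<ge> r} = prob {\<omega> \<in> space M. \<bar>?X \<omega> - expectation ?X\<bar> \<ge> r}"
    unfolding mean by (intro arg_cong[where f=prob]) (auto simp: start_zero)
  also have "\<dots> \<le> variance ?X / r\<^sup>2"
    by (rule Chebyshev_inequality[OF _ int assms(2)]) simp
  finally show ?thesis unfolding var .
qed

text \<open>At horizon \<open>T\<close> the series is bounded on \<open>stay T\<close>, and it is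
  close to 1 there unless \<open>W T\<close> is of order \<open>T\<close>. By Chebyshev the latter
  has probability of order \<open>1 / T\<close>.\<close>

lemma wedge_prob_eq_doob_sum:
  assumes pos: "a1 > 0" "b1 > 0" "a2 > 0" "b2 > 0"
  shows "wedge_prob M W a1 b1 a2 b2 = infsum (doob_term a1 a2 b1 b2) UNIV"
proof -
  define H where "H u v = infsum (doob_term a1 a2 u v) UNIV" for u v
  define stay where "stay T = {\<omega> \<in> space M. \<forall>s\<in>{0..T}. - a1 * s - b1 \<le> W s \<omega> \<and> W s \<omega> \<le> a2 * s + b2}" for T
  define \<kappa> where "\<kappa> = min a1 a2"
  \<comment> \<open>Half the smaller slope: if \<open>|W T|\<close> is below
    \<open>\<delta> * T\<close>, each line is still at distance at least
    \<open>\<kappa> * T - \<delta> * T = \<delta> * T\<close>.\<close>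
  define \<delta> where "\<delta> = \<kappa> / 2"
  have \<kappa>: "0 < \<kappa>" "\<kappa> \<le> a1" "\<kappa> \<le> a2" and \<delta>: "0 < \<delta>" using pos by (auto simp: \<kappa>_def \<delta>_def)
  let ?g = "doob_majorant ((a1 + a2) * (b1 + b2))"
  define G where "G = infsum ?g UNIV"
  define L where "L = infsum (doob_majorant ((a1 + a2) * 2)) UNIV"
  have gs: "?g summable_on UNIV" using pos by (intro doob_majorant_summable) simp
  have G0: "0 \<le> G" unfolding G_def by (intro infsum_nonneg) (simp add: doob_majorant_def)
  have L0: "0 \<le> L" unfolding L_def by (intro infsum_nonneg) (simp add: doob_majorant_def)
  have stay_sets[measurable]: "stay T \<in> sets M" if "T > 0" for T
    unfolding stay_def by (rule doob_sum_expectation(1)[OF pos that])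
  have est: "\<bar>H b1 b2 - prob (stay T)\<bar> \<le> exp (- 2 * (\<delta> * T - 1) * \<kappa>) * L + (G + 1) * (T / (\<delta> * T)\<^sup>2)"
    if T: "T > 0" "1 \<le> \<delta> * T" for T
  proof -
    define h where "h \<omega> = H (b1 + a1 * T + W T \<omega>) (b2 + a2 * T - W T \<omega>)" for \<omega>
    let ?far = "{\<omega> \<in> space M. \<bar>W T \<omega>\<bar> \<ge> \<delta> * T}"
    let ?e = "exp (- 2 * (\<delta> * T - 1) * \<kappa>) * L"
    have [measurable]: "W T \<in> borel_measurable M" using W_measurable T by auto
    have far_sets: "?far \<in> sets M" by measurable
    have Sm: "stay T \<in> sets M" using stay_sets T by simp
    have hi: "integrable M (\<lambda>\<omega>. indicator (stay T) \<omega> * h \<omega>)" "expectation (\<lambda>\<omega>. indicator (stay T) \<omega> * h \<omega>) = H b1 b2"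
      using doob_sum_expectation(2,3)[OF pos T(1)] unfolding h_def H_def stay_def by auto
    have si: "integrable M (indicator (stay T) :: _ \<Rightarrow> real)"
      using Sm by (simp add: less_top[symmetric] emeasure_eq_measure)
    have fi: "integrable M (indicator ?far :: _ \<Rightarrow> real)"
      using far_sets by (simp add: less_top[symmetric] emeasure_eq_measure)
    have pt: "\<bar>indicator (stay T) \<omega> * h \<omega> - indicator (stay T) \<omega>\<bar> \<le> ?e + (G + 1) * indicator ?far \<omega>"
      if \<omega>: "\<omega> \<in> space M" for \<omega>
    proof (cases "\<omega> \<in> stay T")
      case False
      then show ?thesis using G0 L0 by simp
    next
      case True
      then have "- a1 * T - b1 \<le> W T \<omega> \<and> W T \<omega> \<le> a2 * T + b2" using T by (auto simp: stay_def)
      then have uv: "0 \<le> b1 + a1 * T + W T \<omega>" "0 \<le> b2 + a2 * T - W T \<omega>" by auto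
      show ?thesis
      proof (cases "\<omega> \<in> ?far")
        case True
        have "norm (h \<omega>) \<le> G"
          unfolding h_def H_def G_def
        proof (rule norm_infsum_le[OF has_sum_infsum has_sum_infsum[OF gs]])
          show le: "norm (doob_term a1 a2 (b1 + a1 * T + W T \<omega>) (b2 + a2 * T - W T \<omega>) n) \<le> ?g n" for n
            unfolding real_norm_def using pos uv T by (intro abs_doob_term_le) auto
          show "doob_term a1 a2 (b1 + a1 * T + W T \<omega>) (b2 + a2 * T - W T \<omega>) summable_on UNIV"
            by (rule abs_summable_summable, rule summable_on_comparison_test[OF gs le]) auto
        qed
        then have "\<bar>h \<omega> - 1\<bar> \<le> G + 1" by simp
        then show ?thesis using True \<open>\<omega> \<in> stay T\<close> L0 by (simp add: add_increasing)
      next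
        case False
        have t: "\<kappa> * T \<le> a1 * T" "\<kappa> * T \<le> a2 * T" "\<kappa> * T = \<delta> * T + \<delta> * T"
          using \<kappa> T by (auto simp: \<delta>_def)
        have "\<bar>W T \<omega>\<bar> < \<delta> * T" using False \<omega> by auto
        then have "\<delta> * T \<le> b1 + a1 * T + W T \<omega>" "\<delta> * T \<le> b2 + a2 * T - W T \<omega>"
          using t pos by linarith+
        then have "\<bar>h \<omega> - 1\<bar> \<le> ?e"
          unfolding h_def H_def L_def \<kappa>_def using pos T by (intro doob_sum_near_1) auto
        then show ?thesis using False \<open>\<omega> \<in> stay T\<close> by simp
      qed
    qed
    have "H b1 b2 - prob (stay T) = expectation (\<lambda>\<omega>. indicator (stay T) \<omega> * h \<omega> - indicator (stay T) \<omega>)"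
      using hi si Sm by (simp add: Bochner_Integration.integral_diff[OF hi(1) si])
    also have "\<bar>\<dots>\<bar> \<le> expectation (\<lambda>\<omega>. \<bar>indicator (stay T) \<omega> * h \<omega> - indicator (stay T) \<omega>\<bar>)"
      by (rule integral_abs_bound)
    also have "\<dots> \<le> expectation (\<lambda>\<omega>. ?e + (G + 1) * indicator ?far \<omega>)"
      by (intro integral_mono integrable_abs Bochner_Integration.integrable_diff Bochner_Integration.integrable_add
          integrable_mult_right hi(1) si fi pt) auto
    also have "\<dots> = ?e + (G + 1) * prob ?far"
      using far_sets fi by (simp add: prob_space)
    also have "\<dots> \<le> ?e + (G + 1) * (T / (\<delta> * T)\<^sup>2)"
      using prob_abs_W_ge[OF T(1), of "\<delta> * T"] \<delta> T G0 by (intro add_left_mono mult_left_mono) auto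
    finally show ?thesis .
  qed
  let ?err = "\<lambda>N::nat. exp (- 2 * (\<delta> * real (Suc N) - 1) * \<kappa>) * L + (G + 1) * (real (Suc N) / (\<delta> * real (Suc N))\<^sup>2)"
  have err: "?err \<longlonglongrightarrow> 0"
    using \<delta> \<kappa>(1) by real_asymp
  have big: "\<forall>\<^sub>F N in sequentially. 1 \<le> \<delta> * real (Suc N)"
    using \<delta> by real_asymp
  have "(\<lambda>N. H b1 b2 - prob (stay (real (Suc N)))) \<longlonglongrightarrow> 0"
    by (rule Lim_null_comparison[OF _ err]) (use big in eventually_elim, use est in simp)
  then have lim1: "(\<lambda>N. prob (stay (real (Suc N)))) \<longlonglongrightarrow> H b1 b2"
    using tendsto_diff[OF tendsto_const[of "H b1 b2"]] by fastforce
  \<comment> \<open>Continuity from above: the events of no exit decrease in the horizon to the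
    wedge event.\<close>
  have "(\<lambda>N. prob (stay (real (Suc N)))) \<longlonglongrightarrow> prob (\<Inter>N. stay (real (Suc N)))"
  proof (rule finite_Lim_measure_decseq)
    show "range (\<lambda>N. stay (real (Suc N))) \<subseteq> sets M" using stay_sets by auto
    show "decseq (\<lambda>N. stay (real (Suc N)))"
      unfolding decseq_def stay_def by auto
  qed
  also have "(\<Inter>N. stay (real (Suc N))) = {\<omega> \<in> space M. \<forall>t\<ge>0. - a1 * t - b1 \<le> W t \<omega> \<and> W t \<omega> \<le> a2 * t + b2}"
  proof (intro equalityI subsetI)
    fix \<omega> assume \<omega>: "\<omega> \<in> (\<Inter>N. stay (real (Suc N)))"
    have "- a1 * t - b1 \<le> W t \<omega> \<and> W t \<omega> \<le> a2 * t + b2" if "t \<ge> 0" for t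
    proof -
      obtain N :: nat where "t \<le> real N" using real_arch_simple by blast
      then have "t \<in> {0..real (Suc N)}" using that by auto
      moreover have "\<omega> \<in> stay (real (Suc N))" using \<omega> by blast
      ultimately show ?thesis unfolding stay_def by blast
    qed
    moreover have "\<omega> \<in> space M" using \<omega> by (auto simp: stay_def)
    ultimately show "\<omega> \<in> {\<omega> \<in> space M. \<forall>t\<ge>0. - a1 * t - b1 \<le> W t \<omega> \<and> W t \<omega> \<le> a2 * t + b2}" by blast
  qed (auto simp: stay_def)
  finally show ?thesis
    using LIMSEQ_unique[OF lim1] unfolding wedge_prob_def H_def by simp
qed

end

section \<open>From Doob's series to the cosine series\<close>

lemma gaussian_periodization_summable:
  fixes \<alpha> x :: real
  assumes "\<alpha> > 0"
  shows "(\<lambda>n::int. exp (- \<alpha> * (of_int n + x)\<^sup>2)) summable_on UNIV"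
  by (rule summable_on_comparison_test[OF summable_on_exp_linear_minus_square[OF assms, of "2 * \<alpha> * \<bar>x\<bar>"]])
    (use gaussian_periodization_bound[OF assms order_refl] in auto)

lemma poisson_dual_summable:
  fixes \<alpha> x :: real
  assumes "\<alpha> > 0"
  shows "(\<lambda>m::int. exp (- (pi\<^sup>2 * (of_int m)\<^sup>2 / \<alpha>)) * cos (2 * pi * of_int m * x)) summable_on UNIV"
proof (rule abs_summable_summable, rule summable_on_comparison_test)
  show "(\<lambda>m::int. exp (0 * \<bar>of_int m\<bar> - (pi\<^sup>2 / \<alpha>) * (of_int m)\<^sup>2)) summable_on UNIV"
    using assms by (intro summable_on_exp_linear_minus_square) simp
  show "norm (exp (- (pi\<^sup>2 * (of_int m)\<^sup>2 / \<alpha>)) * cos (2 * pi * of_int m * x))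
      \<le> exp (0 * \<bar>of_int m\<bar> - (pi\<^sup>2 / \<alpha>) * (of_int m)\<^sup>2)" for m :: int
    by (simp add: abs_mult mult_left_le)
qed auto

text \<open>Evenness folds the sum onto the positive integers with a factor 2, and grouping an odd
  index with the next even one produces the shape of \<open>wedge_term\<close>.\<close>

lemma even_has_sum_imp_sums_pairs:
  fixes f :: "int \<Rightarrow> real"
  assumes "(f has_sum S) UNIV" "\<And>m. f (- m) = f m" "f 0 = 0"
  shows "(\<lambda>n. 2 * (f (2 * int n + 1) + f (2 * int n + 2))) sums S"
proof -
  \<comment> \<open>The half-open interval misses its right endpoint, so
    \<open>f (2 * int N)\<close> is added by hand; it tends to 0.\<close>
  have part: "(\<Sum>n<N. 2 * (f (2 * int n + 1) + f (2 * int n + 2))) =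
      (\<Sum>m\<in>{- int (2 * N)..<int (2 * N)}. f m) + f (2 * int N)" for N
  proof (induction N)
    case (Suc N)
    have "{- int (2 * Suc N)..<int (2 * Suc N)} =
        {- (2 * int N + 2), - (2 * int N + 1), 2 * int N, 2 * int N + 1} \<union> {- int (2 * N)..<int (2 * N)}"
      by auto
    then have "(\<Sum>m\<in>{- int (2 * Suc N)..<int (2 * Suc N)}. f m) =
        (\<Sum>m\<in>{- (2 * int N + 2), - (2 * int N + 1), 2 * int N, 2 * int N + 1}. f m) + (\<Sum>m\<in>{- int (2 * N)..<int (2 * N)}. f m)"
      by (simp only:) (intro sum.union_disjoint; auto)
    also have "(\<Sum>m\<in>{- (2 * int N + 2), - (2 * int N + 1), 2 * int N, 2 * int N + 1}. f m) =
        f (2 * int N + 2) + f (2 * int N + 1) + f (2 * int N) + f (2 * int N + 1)"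
      using assms(2)[of "2 * int N + 2"] assms(2)[of "2 * int N + 1"] by simp
    finally show ?case using Suc by (simp add: algebra_simps)
  qed (simp add: assms)
  have dbl: "filterlim (\<lambda>N. 2 * N) sequentially sequentially"
    by (rule filterlim_subseq) (auto simp: strict_mono_def)
  have 1: "(\<lambda>N. \<Sum>m\<in>{- int N..<int N}. f m) \<longlonglongrightarrow> S"
    by (rule filterlim_compose[OF _ filterlim_int_intervals]) (use assms(1) in \<open>simp add: has_sum_def\<close>)
  have 2: "(\<lambda>N. f (int N)) \<longlonglongrightarrow> 0"
  proof -
    have "f summable_on range int"
      by (rule summable_on_subset_banach[OF has_sum_imp_summable[OF assms(1)]]) simp
    then have "(\<lambda>n. f (int n)) summable_on UNIV" by (simp add: summable_on_reindex o_def)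
    then show ?thesis by (intro summable_LIMSEQ_zero summable_on_imp_summable)
  qed
  have "(\<lambda>N. (\<Sum>m\<in>{- int (2 * N)..<int (2 * N)}. f m) + f (int (2 * N))) \<longlonglongrightarrow> S + 0"
    by (intro tendsto_add filterlim_compose[OF 1 dbl] filterlim_compose[OF 2 dbl])
  then show ?thesis unfolding sums_def part by simp
qed

text \<open>Both exponents are quadratics in n with leading coefficient \<open>4 * p\<close>, so
  both families are Gaussians of the same width, centred at different points. Poisson summation puts
  the centres into cosines, and the half-integer part of \<open>y\<close> becomes the sign of
  \<open>(-1)^m\<close>, which separates even from odd indices.\<close>

lemma doob_sum_eq_theta:
  fixes a1 b1 a2 b2 :: real
  assumes pos: "a1 > 0" "b1 > 0" "a2 > 0" "b2 > 0"
    and ap: "ap = (a1 + a2) / 2" and bp: "bp = (b1 + b2) / 2"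
    and c: "c = (a1 * b1 - a2 * b2) / 2" and d: "d = (a1 * b2 - a2 * b1) / 2"
  shows "(\<lambda>n. sqrt (pi / (2 * ap * bp)) * exp (d\<^sup>2 / (2 * ap * bp)) * wedge_term ap bp c d (Suc n)) sums
    infsum (doob_term a1 a2 b1 b2) UNIV"
proof -
  define p where "p = ap * bp"
  have p: "p > 0" "4 * p = (a1 + a2) * (b1 + b2)" using pos by (auto simp: p_def ap bp)
  define \<alpha> where "\<alpha> = 8 * p"
  have \<alpha>: "\<alpha> > 0" using p by (simp add: \<alpha>_def)
  define x where "x = d / (4 * p)"
  define y where "y = - 1 / 2 - c / (4 * p)"
  define C where "C = exp (d\<^sup>2 / (2 * p))"
  have e1: "exp (- 2 * doob_exponent1 a1 a2 b1 b2 n) = C * exp (- \<alpha> * (of_int n + x)\<^sup>2)" for n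
  proof -
    have "doob_exponent1 a1 a2 b1 b2 n = 4 * p * (of_int n)\<^sup>2 + 2 * d * of_int n"
      unfolding p(2) d doob_exponent1_def by (simp add: power2_eq_square field_simps)
    moreover have "- \<alpha> * (of_int n + x)\<^sup>2 = - 2 * (4 * p * (of_int n)\<^sup>2 + 2 * d * of_int n) - d\<^sup>2 / (2 * p)"
      unfolding \<alpha>_def x_def using p(1) by (simp add: power2_eq_square field_simps)
    ultimately show ?thesis by (simp add: C_def flip: exp_add)
  qed
  have e2: "exp (- 2 * doob_exponent2 a1 a2 b1 b2 n) = C * exp (- \<alpha> * (of_int n + y)\<^sup>2)" for n
  proof -
    \<comment> \<open>In the variable \<open>n - 1/2\<close> the linear coefficient of the second
      exponent is exactly \<open>- 2 * c\<close>.\<close>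
    define q where "q = of_int n - 1 / (2::real)"
    have 1: "doob_exponent2 a1 a2 b1 b2 n = 4 * p * q\<^sup>2 - 2 * c * q + (a1 - a2) * (b1 - b2) / 4"
      unfolding p(2) c doob_exponent2_def q_def by (simp add: power2_eq_square field_simps)
    \<comment> \<open>This identity absorbs the constant left over from the second square, so both
      families share the prefactor \<open>C\<close>.\<close>
    have "c\<^sup>2 - d\<^sup>2 = 4 * p * ((a1 - a2) * (b1 - b2) / 4)"
      unfolding p(2) c d by (simp add: power2_eq_square field_simps)
    then have 2: "c\<^sup>2 / (2 * p) = d\<^sup>2 / (2 * p) + 2 * ((a1 - a2) * (b1 - b2) / 4)"
      using p(1) by (simp add: field_simps)
    have nq: "of_int n + y = q - c / (4 * p)" by (simp add: q_def y_def)
    have "- \<alpha> * (of_int n + y)\<^sup>2 = - 2 * (4 * p * q\<^sup>2 - 2 * c * q) - c\<^sup>2 / (2 * p)"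
      unfolding nq \<alpha>_def using p(1) by (simp add: power2_eq_square field_simps)
    then show ?thesis unfolding 1 2 by (simp add: C_def flip: exp_add)
  qed
  define w where "w m = exp (- (pi\<^sup>2 * (of_int m)\<^sup>2 / \<alpha>))" for m :: int
  \<comment> \<open>The two dual series agree at \<open>m = 0\<close>, so \<open>f 0 = 0\<close> and
    no constant term remains.\<close>
  define f where "f m = w m * cos (2 * pi * of_int m * x) - w m * cos (2 * pi * of_int m * y)" for m :: int
  have poisson: "((\<lambda>n::int. exp (- \<alpha> * (of_int n + z)\<^sup>2)) has_sum
      (sqrt (pi / \<alpha>) * infsum (\<lambda>m::int. w m * cos (2 * pi * of_int m * z)) UNIV)) UNIV" for z
    using has_sum_infsum[OF gaussian_periodization_summable[OF \<alpha>, of z]]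
    unfolding gaussian_poisson_summation[OF \<alpha>] w_def .
  have dual: "((\<lambda>m::int. w m * cos (2 * pi * of_int m * z)) has_sum infsum (\<lambda>m::int. w m * cos (2 * pi * of_int m * z)) UNIV) UNIV" for z
    unfolding w_def by (rule has_sum_infsum[OF poisson_dual_summable[OF \<alpha>]])
  define R where "R z = infsum (\<lambda>m::int. w m * cos (2 * pi * of_int m * z)) UNIV" for z
  have "(doob_term a1 a2 b1 b2 has_sum (C * (sqrt (pi / \<alpha>) * R x) + - (C * (sqrt (pi / \<alpha>) * R y)))) UNIV"
    unfolding doob_term_def[abs_def] e1 e2 R_def diff_conv_add_uminus
    by (intro has_sum_add has_sum_uminusI has_sum_cmult_right poisson)
  then have H: "infsum (doob_term a1 a2 b1 b2) UNIV = C * sqrt (pi / \<alpha>) * (R x - R y)"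
    by (simp add: infsumI algebra_simps)
  have f_sum: "(f has_sum (R x - R y)) UNIV"
    unfolding f_def[abs_def] R_def diff_conv_add_uminus
    by (intro has_sum_add has_sum_uminusI dual)
  have sums: "(\<lambda>n. 2 * (f (2 * int n + 1) + f (2 * int n + 2))) sums (R x - R y)"
    by (rule even_has_sum_imp_sums_pairs[OF f_sum]) (simp_all add: f_def w_def)
  have cy: "cos (2 * pi * of_int m * y) = cos (pi * of_int m) * cos (pi * of_int m * c / (2 * p))" for m :: int
  proof -
    have "2 * pi * of_int m * y = - (pi * of_int m + pi * of_int m * c / (2 * p))"
      unfolding y_def using p(1) by (simp add: field_simps)
    then have "cos (2 * pi * of_int m * y) = cos (pi * of_int m + pi * of_int m * c / (2 * p))"
      by (simp only: cos_minus)
    also have "\<dots> = cos (pi * of_int m) * cos (pi * of_int m * c / (2 * p))"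
      using sin_npi_int[of m] by (simp add: cos_add)
    finally show ?thesis .
  qed
  have cx: "2 * pi * of_int m * x = pi * of_int m * d / (2 * p)" for m :: int
    unfolding x_def using p(1) by (simp add: field_simps)
  have t: "f (2 * int n + 1) + f (2 * int n + 2) = wedge_term ap bp c d (Suc n)" for n
  proof -
    have "cos (pi * of_int (2 * int n + 1)) = -1" "cos (pi * of_int (2 * int n + 2)) = 1"
      unfolding cos_npi_int by simp_all
    moreover have "of_int (2 * int n + 1) = 2 * real (Suc n) - 1" "of_int (2 * int n + 2) = 2 * real (Suc n)" by simp_all
    ultimately show ?thesis
      unfolding f_def w_def cy cx wedge_term_def \<alpha>_def p_def
      by (simp only:) (simp add: algebra_simps)
  qed
  \<comment> \<open>The factor 2 from folding the sum changes \<open>8 * p\<close> under the root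
    into \<open>2 * p\<close>.\<close>
  have "2 * sqrt (pi / \<alpha>) = sqrt (pi / (2 * p))"
  proof -
    have "pi / (2 * p) = 2\<^sup>2 * (pi / \<alpha>)" by (simp add: \<alpha>_def)
    then show ?thesis by (simp only: real_sqrt_mult real_sqrt_abs abs_numeral)
  qed
  then have "infsum (doob_term a1 a2 b1 b2) UNIV = (sqrt (pi / (2 * p)) * C / 2) * (R x - R y)"
    unfolding H by (simp add: field_simps)
  moreover have "(\<lambda>n. (sqrt (pi / (2 * p)) * C / 2) * (2 * wedge_term ap bp c d (Suc n))) sums
      ((sqrt (pi / (2 * p)) * C / 2) * (R x - R y))"
    using sums unfolding t by (rule sums_mult)
  ultimately have "(\<lambda>n. (sqrt (pi / (2 * p)) * C / 2) * (2 * wedge_term ap bp c d (Suc n))) sums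
      infsum (doob_term a1 a2 b1 b2) UNIV"
    by (simp only:)
  then show ?thesis by (simp add: p_def C_def mult.assoc)
qed

theorem proposition2p1:
  fixes M :: "'a measure" and F :: "real \<Rightarrow> 'a measure" and W :: "real \<Rightarrow> 'a \<Rightarrow> real"
    and a1 b1 a2 b2 ap bp c d :: real
  assumes "standard_brownian_motion M F W"
    and "a1 > 0" and "b1 > 0" and "a2 > 0" and "b2 > 0"
    and "ap = (a1 + a2) / 2" and "bp = (b1 + b2) / 2"
    and "c = (a1 * b1 - a2 * b2) / 2" and "d = (a1 * b2 - a2 * b1) / 2"
  shows "summable (\<lambda>n. wedge_term ap bp c d (Suc n)) \<and>
    wedge_prob M W a1 b1 a2 b2 =
      sqrt (pi / (2 * ap * bp)) * exp (d\<^sup>2 / (2 * ap * bp)) *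
        (\<Sum>n. wedge_term ap bp c d (Suc n))"
proof -
  define K where "K = sqrt (pi / (2 * ap * bp)) * exp (d\<^sup>2 / (2 * ap * bp))"
  have K: "K \<noteq> 0" using assms(2-7) by (simp add: K_def)
  have "(\<lambda>n. K * wedge_term ap bp c d (Suc n)) sums wedge_prob M W a1 b1 a2 b2"
    using doob_sum_eq_theta[OF assms(2-9)]
      standard_brownian_motion.wedge_prob_eq_doob_sum[OF assms(1-5)] by (simp add: K_def)
  \<comment> \<open>Dividing by the nonzero prefactor yields summability of the bare series, so the
    infinite sum in the conclusion is a genuine limit.\<close>
  from sums_mult[OF this, of "inverse K"] K
  have "(\<lambda>n. wedge_term ap bp c d (Suc n)) sums (inverse K * wedge_prob M W a1 b1 a2 b2)"
    by (simp add: mult.assoc[symmetric])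
  with K show ?thesis unfolding K_def[symmetric] by (simp add: sums_iff)
qed

end
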